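(* There exists a polynomial-time algorithm which, given input $(A,\boldsymbol{b})$, where $A=(B\,|\,N)\in\mathbb{Z}^{2\times n}$, $n>2$, $B\in\mathbb{Z}^{2\times 2}$ is nonsingular with $\mathcal{C}_B=\mathcal{C}_A$, the matrix $A$ satisfies (i) $\gcd(A)=1$, (ii) $\{\boldsymbol{x}\in\mathbb{R}^n_{\ge 0}: A\boldsymbol{x}=\boldsymbol{0}\}=\{\boldsymbol{0}\}$, and $$\boldsymbol{b}\in\mathbb{Z}^2\cap\left(\frac{l_B\,l_N}{|\det(B)|}\left(|\det(B)|-1\right)\boldsymbol{v}+\mathcal{C}_A\right),$$ computes a nonnegative integer solution $\boldsymbol{x}\in\mathbb{Z}^n_{\ge 0}$ to the system $A\boldsymbol{x}=\boldsymbol{b}$.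
   Context: The dimension $n$ is part of the input (not fixed). Polynomial time means polynomial in the binary encoding size of the input $(A,\boldsymbol{b})$. The notation $A=(B\,|\,N)$ means that $B$ consists of the first $2$ columns of $A$ and $N\in\mathbb{Z}^{2\times(n-2)}$ of the remaining columns. $l_B$ and $l_N$ denote the Euclidean lengths of the longest columns of $B$ and $N$, respectively. $\gcd(A)$ denotes the greatest common divisor of all $2\times 2$ subdeterminants of $A$. $\mathcal{C}_A$ and $\mathcal{C}_B$ denote the cones in $\mathbb{R}^2$ generated by the columns of $A$ and of $B$, respectively (all linear combinations with nonnegative real coefficients). $\boldsymbol{v}=\boldsymbol{v}_1+\cdots+\boldsymbol{v}_n$ is the sum of all columns $\boldsymbol{v}_1,\ldots,\boldsymbol{v}_n$ of $A$. For a point $\boldsymbol{p}$ and a set $X$, $\boldsymbol{p}+X=\{\boldsymbol{p}+\boldsymbol{x}:\boldsymbol{x}\in X\}$. *)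

theory Defs
  imports
    Complex_Main
    "HOL-Library.Log_Nat"
    "HOL-Library.Set_Algebras"
    "Jordan_Normal_Form.Determinant"
begin

section \<open>A random access machine with logarithmic cost\<close>

text \<open>
  Algorithms are programs of a deterministic random access machine over the integers under the
  logarithmic cost criterion. The memory has one cell for every integer address. Each operation is
  charged for the binary size of all operands, addresses included, and multiplication and division
  are charged the product of the operand sizes. Hence a multitape Turing machine can simulate a run
  of cost \<open>t\<close> on an input of size \<open>m\<close> in time polynomial in \<open>t + m\<close>, and conversely, so that
  polynomial cost means polynomial time in the usual bit model.
\<close>

type_synonym memory = "int \<Rightarrow> int"

datatype expr =
    Const int
  | Cell expr
  | Add expr expr
  | Sub expr expr
  | Mul expr expr
  | Div expr expr

datatype program =
    Assign expr expr
  | Seq program program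
  | IfPos expr program program
  | WhilePos expr program

text \<open>One bit for the sign, followed by the bits of the absolute value.\<close>

definition bsize :: "int \<Rightarrow> nat" where
  "bsize x = 1 + nat (bitlen \<bar>x\<bar>)"

text \<open>\<open>Cell e\<close> reads the cell whose address is the value of \<open>e\<close> (indirect addressing).
  \<open>Div\<close> rounds down, and division by zero yields zero.\<close>

fun val :: "expr \<Rightarrow> memory \<Rightarrow> int" where
  "val (Const c) s = c"
| "val (Cell e) s = s (val e s)"
| "val (Add e f) s = val e s + val f s"
| "val (Sub e f) s = val e s - val f s"
| "val (Mul e f) s = val e s * val f s"
| "val (Div e f) s = val e s div val f s"

fun cost :: "expr \<Rightarrow> memory \<Rightarrow> nat" where
  "cost (Const c) s = bsize c"
| "cost (Cell e) s = cost e s + bsize (val e s) + bsize (s (val e s))"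
| "cost (Add e f) s = cost e s + cost f s + bsize (val e s) + bsize (val f s)"
| "cost (Sub e f) s = cost e s + cost f s + bsize (val e s) + bsize (val f s)"
| "cost (Mul e f) s = cost e s + cost f s + bsize (val e s) * bsize (val f s)"
| "cost (Div e f) s = cost e s + cost f s + bsize (val e s) * bsize (val f s)"

text \<open>\<open>exec P s t s'\<close>: started in memory \<open>s\<close>, the program \<open>P\<close> halts with memory \<open>s'\<close> after a run
  of total cost \<open>t\<close>. In \<open>Assign a e\<close> the expression \<open>a\<close> computes the address that is written.\<close>

inductive exec :: "program \<Rightarrow> memory \<Rightarrow> nat \<Rightarrow> memory \<Rightarrow> bool" where
  Assign: "exec (Assign a e) s (cost a s + cost e s + bsize (val a s) + bsize (val e s))
             (s(val a s := val e s))"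
| Seq: "exec P s t s' \<Longrightarrow> exec Q s' u s'' \<Longrightarrow> exec (Seq P Q) s (t + u) s''"
| IfTrue: "val e s > 0 \<Longrightarrow> exec P s t s' \<Longrightarrow>
     exec (IfPos e P Q) s (cost e s + bsize (val e s) + t) s'"
| IfFalse: "\<not> val e s > 0 \<Longrightarrow> exec Q s t s' \<Longrightarrow>
     exec (IfPos e P Q) s (cost e s + bsize (val e s) + t) s'"
| WhileTrue: "val e s > 0 \<Longrightarrow> exec P s t s' \<Longrightarrow> exec (WhilePos e P) s' u s'' \<Longrightarrow>
     exec (WhilePos e P) s (cost e s + bsize (val e s) + t + u) s''"
| WhileFalse: "\<not> val e s > 0 \<Longrightarrow> exec (WhilePos e P) s (cost e s + bsize (val e s)) s"

inductive_cases Assign_execE: "exec (Assign a e) s t s'"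
inductive_cases Seq_execE: "exec (Seq P Q) s t s'"
inductive_cases If_execE: "exec (IfPos e P Q) s t s'"
inductive_cases While_execE: "exec (WhilePos e P) s t s'"

text \<open>By determinism, the existence of one halting run of cost \<open>t\<close> says that \<open>P\<close> halts, with cost
  \<open>t\<close> and the given result.\<close>

lemma exec_deterministic:
  assumes "exec P s t s'" and "exec P s u s''"
  shows "u = t \<and> s'' = s'"
  using assms
proof (induction arbitrary: u s'' rule: exec.induct)
  case Assign
  then show ?case by (auto elim: Assign_execE)
next
  case (Seq P s t s' Q v s2)
  from Seq.prems show ?case by (rule Seq_execE) (use Seq.IH in blast)
next
  case (IfTrue e s P t s' Q)
  from IfTrue.prems show ?case by (rule If_execE) (use IfTrue in blast)+
next
  case (IfFalse e s Q t s' P)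
  from IfFalse.prems show ?case by (rule If_execE) (use IfFalse in blast)+
next
  case (WhileTrue e s P t s' v s2)
  from WhileTrue.prems show ?case by (rule While_execE) (use WhileTrue in blast)+
next
  case (WhileFalse e s P)
  from WhileFalse.prems show ?case by (rule While_execE) (use WhileFalse in blast)+
qed

text \<open>The input occupies the cells \<open>0, 1, 2, \<dots>\<close>; all other cells, in particular those with negative
  addresses, are initially zero.\<close>

definition load :: "int list \<Rightarrow> memory" where
  "load xs = (\<lambda>a. if 0 \<le> a \<and> a < int (length xs) then xs ! nat a else 0)"

definition binary_size :: "int list \<Rightarrow> nat" where
  "binary_size xs = (\<Sum>x\<leftarrow>xs. bsize x)"

text \<open>The cells \<open>0, \<dots>, n - 1\<close> hold the vector \<open>x\<close> of dimension \<open>n\<close>.\<close>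

definition holds_vec :: "memory \<Rightarrow> int vec \<Rightarrow> bool" where
  "holds_vec s x \<longleftrightarrow> (\<forall>i < dim_vec x. s (int i) = x $ i)"

text \<open>The number of columns, then \<open>b\<close>, then the columns of \<open>A\<close> one after the other.\<close>

definition encode :: "int mat \<Rightarrow> int vec \<Rightarrow> int list" where
  "encode A b = int (dim_col A) # list_of_vec b @ concat (map list_of_vec (cols A))"


section \<open>Integer matrices\<close>

definition block_row :: "'a mat \<Rightarrow> 'a mat \<Rightarrow> 'a mat" where
  "block_row B N = mat_of_cols (dim_row B) (cols B @ cols N)"

abbreviation real_mat :: "int mat \<Rightarrow> real mat" where
  "real_mat \<equiv> map_mat real_of_int"

abbreviation real_vec :: "int vec \<Rightarrow> real vec" where
  "real_vec \<equiv> map_vec real_of_int"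

definition euclidean_length :: "real vec \<Rightarrow> real" where
  "euclidean_length v = sqrt (v \<bullet> v)"

text \<open>Only meaningful for matrices with at least one column.\<close>

definition longest_column :: "int mat \<Rightarrow> real" where
  "longest_column M = Max ((\<lambda>c. euclidean_length (real_vec c)) ` set (cols M))"

text \<open>Only used for matrices with two rows, whose 2x2 submatrices are given by pairs of columns.\<close>

definition gcd_minors2 :: "int mat \<Rightarrow> int" where
  "gcd_minors2 A = Gcd {det (mat_of_cols 2 [col A i, col A j]) | i j. i < j \<and> j < dim_col A}"

definition col_cone :: "int mat \<Rightarrow> real vec set" where
  "col_cone M = {real_mat M *\<^sub>v x | x. x \<in> carrier_vec (dim_col M) \<and> 0\<^sub>v (dim_col M) \<le> x}"

definition col_sum :: "int mat \<Rightarrow> int vec" where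
  "col_sum M = vec (dim_row M) (\<lambda>i. \<Sum>j < dim_col M. M $$ (i, j))"

end

theory Submission
  imports Defs
begin

text \<open>
  Let \<open>D = \<bar>det B\<bar>\<close>. Adjoin the columns of \<open>A\<close> one at a time to the lattice \<open>D\<^sup>2 \<int>\<^sup>2\<close>, keeping a
  basis \<open>(p, q), (0, r)\<close> in Hermite normal form; after the columns of \<open>B\<close> the lattice is \<open>B \<int>\<^sup>2\<close>,
  and in the end it is \<open>\<int>\<^sup>2\<close> because \<open>gcd(A) = 1\<close>. Going back through this chain, some multiple
  \<open>x\<^sub>j\<close> of the column \<open>j\<close> of \<open>N\<close>, reduced modulo the index \<open>\<rho>\<^sub>j\<close> of the \<open>j\<close>-th step, moves the current
  vector into the next smaller lattice, and what remains of \<open>b\<close> lies in \<open>B \<int>\<^sup>2\<close>. The indices multiply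
  to \<open>D\<close>, so that \<open>\<Sum> x\<^sub>j \<le> \<Sum> (\<rho>\<^sub>j - 1) \<le> D - 1\<close>. By Cramer's rule and the Cauchy-Schwarz inequality
  the \<open>B\<close>-coordinates of a column of \<open>N\<close> are at most \<open>l\<^sub>B l\<^sub>N / D\<close>, whereas those of \<open>b\<close> are at least
  \<open>l\<^sub>B l\<^sub>N (D - 1) / D\<close>; hence the remaining coordinates are nonnegative.
\<close>

section \<open>Cost of straight-line programs and loops\<close>

text \<open>What shapes the algorithm is the length of the intermediate numbers. The diagonal
  entries of the Hermite form only pass to divisors of themselves, while the entry \<open>q\<close>
  and the Bezout coefficients are reduced modulo diagonal entries. So one bound \<open>U\<close>,
  whose bit length is linear in the input size, holds for the whole memory between the blocks of the
  program. One column then costs at most cubically much in \<open>bsize U\<close>, and all columns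
  together give a quartic polynomial. Starting from a multiple of \<open>\<int>\<^sup>2\<close>
  makes every lattice of the chain full-dimensional, and this multiple is harmless because already
  \<open>det B\<close> times \<open>\<int>\<^sup>2\<close> lies in \<open>B \<int>\<^sup>2\<close>.
  Indices of subgroups are never treated abstractly. The product \<open>p * r\<close> of the
  diagonal divides the determinant of any two lattice vectors. For the columns of \<open>B\<close>
  this yields that the product of the later indices divides \<open>det B\<close>, which is all that
  the bound on the multiples needs; for all pairs of columns of \<open>A\<close> it forces
  \<open>p = r = 1\<close> at the end.\<close>

lemma bsize_ge_1: "1 \<le> bsize x"
  by (simp add: bsize_def)

lemma bsize_le_iff: "bsize x \<le> Suc k \<longleftrightarrow> \<bar>x\<bar> < 2 ^ k"
proof -
  have "nat (bitlen \<bar>x\<bar>) \<le> k \<longleftrightarrow> \<bar>x\<bar> < 2 ^ k"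
    using bitlen_le_iff_power[of "\<bar>x\<bar>" "k"] by (simp add: nat_le_iff powr_realpow) 
  then show ?thesis by (simp add: bsize_def)
qed

lemma bsize_obtain: obtains k where "bsize x = Suc k" "\<bar>x\<bar> < 2 ^ k"
  using bsize_ge_1[of x] bsize_le_iff[of x "bsize x - 1"] by (metis Suc_diff_le diff_Suc_1 le_refl One_nat_def)

lemma bsize_mono: "\<bar>x\<bar> \<le> \<bar>y\<bar> \<Longrightarrow> bsize x \<le> bsize y"
  by (metis bsize_obtain bsize_le_iff order.strict_trans1 order_refl)

lemma bsize_mult: "bsize (x * y) \<le> bsize x + bsize y"
proof -
  obtain k where k: "bsize x = Suc k" "\<bar>x\<bar> < 2 ^ k" by (rule bsize_obtain)
  obtain l where l: "bsize y = Suc l" "\<bar>y\<bar> < 2 ^ l" by (rule bsize_obtain)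
  have "\<bar>x * y\<bar> < 2 ^ (k + l)"
    unfolding abs_mult power_add using k l by (intro mult_strict_mono') auto
  then have "bsize (x * y) \<le> Suc (k + l)" by (simp only: bsize_le_iff)
  then show ?thesis using k l by simp
qed

lemma bsize_add: "bsize (x + y) \<le> bsize x + bsize y"
proof -
  obtain k where k: "bsize x = Suc k" "\<bar>x\<bar> < 2 ^ k" by (rule bsize_obtain)
  obtain l where l: "bsize y = Suc l" "\<bar>y\<bar> < 2 ^ l" by (rule bsize_obtain)
  have "(2::int) ^ k \<le> 2 ^ (k + l)" "(2::int) ^ l \<le> 2 ^ (k + l)" by simp_all
  then have "\<bar>x + y\<bar> < 2 ^ Suc (k + l)"
    using k(2) l(2) unfolding power_Suc by linarith
  then have "bsize (x + y) \<le> Suc (Suc (k + l))" by (simp only: bsize_le_iff)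
  then show ?thesis using k l by simp
qed

lemma bsize_minus: "bsize (x - y) \<le> bsize x + bsize y"
  using bsize_add[of x "- y"] by (simp add: bsize_def)

text \<open>Rounding down pushes a negative quotient away from zero, but never past the dividend.
  This lets size estimates of quotients ignore the divisor.\<close>

lemma abs_div_le: "\<bar>x div y\<bar> \<le> \<bar>x :: int\<bar>"
proof -
  have *: "\<bar>x div y\<bar> \<le> \<bar>x\<bar>" if "0 < y" for x y :: int
  proof (cases "0 \<le> x")
    case True
    then show ?thesis using that using zdiv_mono2[of x 1 y] by (simp add: pos_imp_zdiv_nonneg_iff)
  next
    case False
    have "x * 1 \<ge> x * y" using that False by (intro mult_left_mono_neg) auto
    then have "x \<le> x div y" using that zdiv_mono1[of "x * y" x y] by simp
    moreover have "x div y < 0" using False that by (simp add: div_neg_pos_less0)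
    ultimately show ?thesis by simp
  qed
  show ?thesis
  proof (cases y "0 :: int" rule: linorder_cases)
    case less
    then show ?thesis using *[of "- y" "- x"] by simp
  qed (use * in auto)
qed

text \<open>If all cells have at most \<open>M\<close> bits, then \<open>weight e * M\<close> bounds
  the bits of the value of \<open>e\<close>. \<open>Cell\<close> has weight 1 whatever its address,
  because its value is again the content of a cell.\<close>

fun weight :: "expr \<Rightarrow> nat" where
  "weight (Const c) = bsize c"
| "weight (Cell e) = 1"
| "weight (Add e f) = weight e + weight f"
| "weight (Sub e f) = weight e + weight f"
| "weight (Mul e f) = weight e + weight f"
| "weight (Div e f) = weight e"

text \<open>The coefficient of \<open>M\<^sup>2\<close> in the cost bound. Products and quotients
  are charged quadratically; the linear charges are absorbed by
  \<open>M \<le> M\<^sup>2\<close>.\<close>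

fun cost_factor :: "expr \<Rightarrow> nat" where
  "cost_factor (Const c) = bsize c"
| "cost_factor (Cell e) = cost_factor e + weight e + 1"
| "cost_factor (Add e f) = cost_factor e + cost_factor f + weight e + weight f"
| "cost_factor (Sub e f) = cost_factor e + cost_factor f + weight e + weight f"
| "cost_factor (Mul e f) = cost_factor e + cost_factor f + weight e * weight f"
| "cost_factor (Div e f) = cost_factor e + cost_factor f + weight e * weight f"

lemma bsize_val:
  assumes "\<And>a. bsize (s a) \<le> M"
  shows "bsize (val e s) \<le> weight e * M"
proof -
  have M: "1 \<le> M" using assms bsize_ge_1 order_trans by blast
  show ?thesis
  proof (induction e)
    case (Const c)
    then show ?case using M by simp
  next
    case (Add e f)
    then show ?case using bsize_add[of "val e s" "val f s"] by (simp add: algebra_simps)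
  next
    case (Sub e f)
    then show ?case using bsize_minus[of "val e s" "val f s"] by (simp add: algebra_simps)
  next
    case (Mul e f)
    then show ?case using bsize_mult[of "val e s" "val f s"] by (simp add: algebra_simps)
  next
    case (Div e f)
    then show ?case using bsize_mono[OF abs_div_le, of "val e s" "val f s"] by simp
  qed (use assms in simp_all)
qed

lemma cost_le:
  assumes "\<And>a. bsize (s a) \<le> M"
  shows "cost e s \<le> cost_factor e * M\<^sup>2"
proof -
  have M: "1 \<le> M" using assms bsize_ge_1 order_trans by blast
  then have MM: "M \<le> M\<^sup>2" "1 \<le> M\<^sup>2" by (simp_all add: power2_eq_square)
  have lin: "bsize (val e s) \<le> weight e * M\<^sup>2" for e
    using bsize_val[of s M e, OF assms] mult_le_mono2[OF MM(1), of "weight e"] by linarith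
  have quad: "bsize (val e s) * bsize (val f s) \<le> weight e * weight f * M\<^sup>2" for e f
    using mult_le_mono[OF bsize_val[of s M e, OF assms] bsize_val[of s M f, OF assms]]
    by (simp add: power2_eq_square mult_ac)
  show ?thesis
  proof (induction e)
    case (Const c)
    then show ?case using MM by simp
  next
    case (Cell e)
    then show ?case using lin[of e] assms[of "val e s"] MM by (simp add: add_mult_distrib)
  next
    case (Add e f)
    then show ?case using lin[of e] lin[of f] by (simp add: add_mult_distrib)
  next
    case (Sub e f)
    then show ?case using lin[of e] lin[of f] by (simp add: add_mult_distrib)
  next
    case (Mul e f)
    then show ?case using quad[of e f] by (simp add: add_mult_distrib)
  next
    case (Div e f)
    then show ?case using quad[of e f] by (simp add: add_mult_distrib)
  qed
qed

text \<open>A total-correctness judgement with a time budget.\<close>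

definition runs_to :: "program \<Rightarrow> memory \<Rightarrow> nat \<Rightarrow> (memory \<Rightarrow> bool) \<Rightarrow> bool" where
  "runs_to P s t Q \<longleftrightarrow> (\<exists>u s'. exec P s u s' \<and> u \<le> t \<and> Q s')"

lemma runs_to_mono:
  assumes "runs_to P s t Q" "t \<le> t'" "\<And>s'. Q s' \<Longrightarrow> Q' s'"
  shows "runs_to P s t' Q'"
  using assms unfolding runs_to_def by (meson order_trans)

lemma runs_to_Seq:
  assumes "runs_to P s t Q" "\<And>s'. Q s' \<Longrightarrow> runs_to P' s' t' Q'"
  shows "runs_to (Seq P P') s (t + t') Q'"
  using assms unfolding runs_to_def by (meson exec.Seq add_mono)

text \<open>The variant \<open>f\<close> allows at most \<open>k\<close> rounds, each paying for one
  guard and one body; the last summand \<open>g\<close> is the guard that fails.\<close>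

lemma runs_to_WhilePos:
  assumes guard: "\<And>s. I s \<Longrightarrow> cost e s + bsize (val e s) \<le> g"
    and body: "\<And>s. I s \<Longrightarrow> val e s > 0 \<Longrightarrow> runs_to P s t (\<lambda>s'. I s' \<and> f s' < (f s :: nat))"
    and "I s" "f s \<le> k"
  shows "runs_to (WhilePos e P) s (k * (t + g) + g) (\<lambda>s'. I s' \<and> \<not> val e s' > 0)"
  using assms(3,4)
proof (induction k arbitrary: s rule: less_induct)
  case (less k)
  show ?case
  proof (cases "val e s > 0")
    case False
    then show ?thesis
      using guard[OF less.prems(1)] less.prems(1) exec.WhileFalse[of e s P]
      unfolding runs_to_def by (meson trans_le_add2)
  next
    case True
    from body[OF less.prems(1) True] obtain u s' where
      1: "exec P s u s'" "u \<le> t" "I s'" "f s' < f s"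
      unfolding runs_to_def by blast
    have k: "k - 1 < k" "f s' \<le> k - 1" "k = Suc (k - 1)" using 1(4) less.prems(2) by linarith+
    from less.IH[OF k(1) 1(3) k(2)] obtain v s'' where
      2: "exec (WhilePos e P) s' v s''" "v \<le> (k - 1) * (t + g) + g" "I s''" "\<not> val e s'' > 0"
      unfolding runs_to_def by blast
    have "exec (WhilePos e P) s (cost e s + bsize (val e s) + u + v) s''"
      by (rule exec.WhileTrue[OF True 1(1) 2(1)])
    moreover have "cost e s + bsize (val e s) + u + v \<le> k * (t + g) + g"
      using guard[OF less.prems(1)] 1(2) 2(2) by (subst k(3)) simp
    ultimately show ?thesis using 2(3,4) unfolding runs_to_def by blast
  qed
qed

text \<open>There is no empty program; copying a cell to itself serves as one.\<close>

fun block :: "(expr \<times> expr) list \<Rightarrow> program" where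
  "block [] = Assign (Const 0) (Cell (Const 0))"
| "block ((a, e) # xs) = Seq (Assign a e) (block xs)"

fun effect :: "(expr \<times> expr) list \<Rightarrow> memory \<Rightarrow> memory" where
  "effect [] s = s"
| "effect ((a, e) # xs) s = effect xs (s(val a s := val e s))"

text \<open>After one assignment the bit bound \<open>M\<close> may have grown to
  \<open>(1 + weight e) * M\<close>, which is squared in the cost of the rest. The growth is
  exponential in the length of the block, but the block is fixed, so this is a constant. The 10 is a
  generous bound for the final self-copy.\<close>

fun block_factor :: "(expr \<times> expr) list \<Rightarrow> nat" where
  "block_factor [] = 10"
| "block_factor ((a, e) # xs) =
     cost_factor a + cost_factor e + weight a + weight e + block_factor xs * (Suc (weight e))\<^sup>2"

lemma runs_to_block_aux:
  assumes "\<And>a. bsize (s a) \<le> M"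
  shows "runs_to (block xs) s (block_factor xs * M\<^sup>2) (\<lambda>s'. s' = effect xs s)"
  using assms
proof (induction xs arbitrary: s M)
  case Nil
  have M: "1 \<le> M" using Nil bsize_ge_1 order_trans by blast
  then have MM: "M \<le> M\<^sup>2" "1 \<le> M\<^sup>2" by (simp_all add: power2_eq_square)
  have "exec (block []) s (cost (Const 0) s + cost (Cell (Const 0)) s + bsize (val (Const 0) s)
      + bsize (val (Cell (Const 0)) s)) (s(val (Const 0) s := val (Cell (Const 0)) s))"
    unfolding block.simps by (rule exec.Assign)
  moreover have "cost (Const 0) s + cost (Cell (Const 0)) s + bsize (val (Const 0) s)
      + bsize (val (Cell (Const 0)) s) \<le> 10 * M\<^sup>2"
    using Nil[of 0] MM by (simp add: bsize_def)
  ultimately show ?case unfolding runs_to_def by auto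
next
  case (Cons x xs)
  obtain a e where x: "x = (a, e)" by (cases x)
  have M: "1 \<le> M" using Cons bsize_ge_1 order_trans by blast
  then have MM: "M \<le> M\<^sup>2" by (simp add: power2_eq_square)
  let ?M = "Suc (weight e) * M"
  let ?s = "s(val a s := val e s)"
  have lin: "bsize (val e s) \<le> weight e * M\<^sup>2" for e
    using bsize_val[of s M e, OF Cons.prems] mult_le_mono2[OF MM(1), of "weight e"] by linarith
  have "bsize (?s b) \<le> ?M" for b
    using bsize_val[of s M e, OF Cons.prems] Cons.prems[of b] by auto
  then have 1: "runs_to (block xs) ?s (block_factor xs * ?M\<^sup>2) (\<lambda>s'. s' = effect xs ?s)"
    by (rule Cons.IH)
  have 2: "runs_to (Assign a e) s ((cost_factor a + cost_factor e + weight a + weight e) * M\<^sup>2)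
      (\<lambda>s'. s' = ?s)"
    unfolding runs_to_def
    using exec.Assign[of a e s] cost_le[of s M a, OF Cons.prems] cost_le[of s M e, OF Cons.prems]
      lin[of a] lin[of e]
    by (intro exI conjI) (assumption, simp_all add: add_mult_distrib)
  have "runs_to (block (x # xs)) s
      ((cost_factor a + cost_factor e + weight a + weight e) * M\<^sup>2 + block_factor xs * ?M\<^sup>2)
      (\<lambda>s'. s' = effect xs ?s)"
    unfolding x block.simps using 1 by (intro runs_to_Seq[OF 2]) simp
  then show ?case
    unfolding x block_factor.simps effect.simps power_mult_distrib
    by (simp only: add_mult_distrib mult.assoc)
qed

definition bounded :: "int \<Rightarrow> memory \<Rightarrow> bool" where
  "bounded U s \<longleftrightarrow> (\<forall>a. \<bar>s a\<bar> \<le> U)"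

lemma bounded_bsize: "bounded U s \<Longrightarrow> bsize (s a) \<le> bsize U"
  unfolding bounded_def by (intro bsize_mono) (metis abs_ge_self order_trans)

text \<open>The bound \<open>U\<close> is required of the initial memory only; growth inside the
  block is already paid for by \<open>block_factor\<close>. Hence bounds have to be restored only
  between blocks.\<close>

lemma runs_to_block:
  assumes "bounded U s" "Q (effect xs s)"
  shows "runs_to (block xs) s (block_factor xs * (bsize U)\<^sup>2) Q"
  using runs_to_block_aux[of s "bsize U" xs, OF bounded_bsize[OF assms(1)]] assms(2)
  by (auto intro: runs_to_mono)

lemma guard_cost:
  assumes "bounded U s"
  shows "cost e s + bsize (val e s) \<le> (cost_factor e + weight e) * (bsize U)\<^sup>2"
proof -
  have M: "1 \<le> bsize U" by (rule bsize_ge_1)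
  then have MM: "bsize U \<le> (bsize U)\<^sup>2" by (simp add: power2_eq_square)
  show ?thesis
    using cost_le[of s "bsize U" e, OF bounded_bsize[OF assms]]
      bsize_val[of s "bsize U" e, OF bounded_bsize[OF assms]] mult_le_mono2[OF MM(1), of "weight e"]
    unfolding add_mult_distrib by linarith
qed

section \<open>Bezout coefficients by the Euclidean algorithm\<close>

abbreviation (input) "rA \<equiv> - 1 :: int"
abbreviation (input) "rC \<equiv> - 2 :: int"
abbreviation (input) "rK \<equiv> - 3 :: int"
abbreviation (input) "rL \<equiv> - 4 :: int"
abbreviation (input) "rS \<equiv> - 5 :: int"
abbreviation (input) "rV \<equiv> - 6 :: int"

abbreviation reg :: "int \<Rightarrow> expr" where
  "reg a \<equiv> Cell (Const a)"

abbreviation Mod :: "expr \<Rightarrow> expr \<Rightarrow> expr" where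
  "Mod e f \<equiv> Sub e (Mul (Div e f) f)"

text \<open>Started with \<open>rA = a\<close>, \<open>rC = c\<close>, \<open>rK = 0\<close>, \<open>rL = 1\<close>, the loop keeps \<open>rA \<equiv> rK * c\<close> and
  \<open>rC \<equiv> rL * c\<close> modulo \<open>a\<close>, the content of the cell \<open>m\<close>. Only the coefficients of \<open>c\<close> are computed,
  reduced modulo \<open>a\<close>.\<close>

definition euclid_step :: "int \<Rightarrow> (expr \<times> expr) list" where
  "euclid_step m =
    [(Const rS, Div (reg rA) (reg rC)),
     (Const rV, Sub (reg rA) (Mul (reg rS) (reg rC))),
     (Const rA, reg rC),
     (Const rC, reg rV),
     (Const rV, Sub (reg rK) (Mul (reg rS) (reg rL))),
     (Const rK, reg rL),
     (Const rL, Mod (reg rV) (reg m))]"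

definition euclid :: "int \<Rightarrow> program" where
  "euclid m = WhilePos (reg rC) (block (euclid_step m))"

text \<open>There are at most \<open>2 * bsize U\<close> rounds; the third copy pays for the failing
  guard.\<close>

definition euclid_factor :: "int \<Rightarrow> nat" where
  "euclid_factor m =
     3 * (block_factor (euclid_step m) + cost_factor (reg rC) + weight (reg rC))"

lemma bsize_less:
  assumes "2 * x \<le> y" "0 \<le> x" "0 < y"
  shows "bsize x < bsize y"
proof -
  obtain k where k: "bsize y = Suc k" "\<bar>y\<bar> < 2 ^ k" by (rule bsize_obtain)
  have "k \<noteq> 0" using k(2) assms(3) by (cases k) auto
  then obtain l where l: "k = Suc l" by (cases k) auto
  have "\<bar>x\<bar> < 2 ^ l" using k(2) assms l by simp
  then have "bsize x \<le> Suc l" by (simp only: bsize_le_iff)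
  then show ?thesis using k l by simp
qed

text \<open>The quotient is at least 1, so \<open>a \<ge> c + a mod c \<ge> 2 * (a mod c)\<close>.
  Hence the product of the two current numbers is at least halved in every single round, and its bit
  length serves as the variant.\<close>

lemma euclid_step_measure:
  assumes "0 < c" "c \<le> (a :: int)"
  shows "bsize (c * (a mod c)) < bsize (a * c)"
proof -
  have "1 * c \<le> (a div c) * c" using assms by (intro mult_right_mono) (auto simp: pos_imp_zdiv_pos_iff int_one_le_iff_zero_less)
  then have "2 * (a mod c) \<le> a"
    using assms div_mult_mod_eq[of a c] pos_mod_bound[of c a] by linarith
  then have "c * (2 * (a mod c)) \<le> c * a" using assms by (intro mult_left_mono) auto
  then show ?thesis using assms by (intro bsize_less) (auto simp: mult_ac)
qed

text \<open>The room \<open>a\<^sub>0 * a\<^sub>0 + a\<^sub>0\<close> is for the difference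
  \<open>rK - q * rL\<close> before its reduction, where all three numbers lie between 0 and
  \<open>a\<^sub>0\<close>. The modulus is reread from cell \<open>m\<close> in each round, so
  \<open>m\<close> must not be a register of the loop.\<close>

lemma runs_to_euclid:
  fixes s :: memory and m :: int
  defines "a\<^sub>0 \<equiv> s m" and "c\<^sub>0 \<equiv> s rC"
  assumes m: "m \<notin> {-6..-1}" and pos: "0 < a\<^sub>0" "0 \<le> c\<^sub>0" "c\<^sub>0 < a\<^sub>0"
    and init: "s rA = a\<^sub>0" "s rK = 0" "s rL = 1"
    and U: "bounded U s" "a\<^sub>0 * a\<^sub>0 + a\<^sub>0 \<le> U"
  shows "runs_to (euclid m) s (euclid_factor m * bsize U ^ 3)
    (\<lambda>s'. bounded U s' \<and> (\<forall>a. a \<notin> {-6..-1} \<longrightarrow> s' a = s a) \<and> s' rA = gcd a\<^sub>0 c\<^sub>0 \<and>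
      a\<^sub>0 dvd s' rA - s' rK * c\<^sub>0 \<and> 0 \<le> s' rK \<and> s' rK \<le> a\<^sub>0)"
proof -
  define I where "I s' \<longleftrightarrow> bounded U s' \<and> (\<forall>a. a \<notin> {-6..-1} \<longrightarrow> s' a = s a) \<and>
      0 \<le> s' rC \<and> s' rC < s' rA \<and> s' rA \<le> a\<^sub>0 \<and> gcd (s' rA) (s' rC) = gcd a\<^sub>0 c\<^sub>0 \<and>
      a\<^sub>0 dvd s' rA - s' rK * c\<^sub>0 \<and> a\<^sub>0 dvd s' rC - s' rL * c\<^sub>0 \<and>
      0 \<le> s' rK \<and> s' rK \<le> a\<^sub>0 \<and> 0 \<le> s' rL \<and> s' rL \<le> a\<^sub>0" for s'
  define f where "f s' = bsize (s' rA * s' rC)" for s' :: memory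
  have "I s"
    unfolding I_def using assms by auto
  have body: "runs_to (block (euclid_step m)) t (block_factor (euclid_step m) * (bsize U)\<^sup>2)
      (\<lambda>t'. I t' \<and> f t' < f t)" if t: "I t" "val (reg rC) t > 0" for t
  proof (rule runs_to_block)
    show "bounded U t" using t unfolding I_def by blast
    let ?t = "effect (euclid_step m) t"
    let ?q = "t rA div t rC"
    have tm: "t m = a\<^sub>0" using t m unfolding I_def a\<^sub>0_def by blast
    have rS: "?t rS = ?q" and rV: "?t rV = t rK - ?q * t rL"
      and rA: "?t rA = t rC" and rC: "?t rC = t rA mod t rC" and rK: "?t rK = t rL"
      and rL: "?t rL = (t rK - ?q * t rL) mod a\<^sub>0"
      and rest: "\<forall>a. a \<notin> {-6..-1} \<longrightarrow> ?t a = t a"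
      using m tm by (auto simp: euclid_step_def minus_div_mult_eq_mod)
    have C: "0 < t rC" "t rC < t rA" "t rA \<le> a\<^sub>0" "0 \<le> t rK" "t rK \<le> a\<^sub>0" "0 \<le> t rL" "t rL \<le> a\<^sub>0"
      using t unfolding I_def by auto
    have q: "0 \<le> ?q" "?q \<le> a\<^sub>0"
      using C zdiv_mono2[of "t rA" 1 "t rC"] by (auto simp: pos_imp_zdiv_nonneg_iff)
    have md: "0 \<le> t rA mod t rC" "t rA mod t rC < t rC" using C by auto
    have "0 \<le> ?q * t rL" "?q * t rL \<le> a\<^sub>0 * a\<^sub>0" using q C pos by (auto intro: mult_mono)
    then have V: "\<bar>?t rV\<bar> \<le> U" unfolding rV using U(2) C pos by linarith
    have "0 \<le> a\<^sub>0 * a\<^sub>0" by simp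
    then have aU: "a\<^sub>0 \<le> U" using U(2) by linarith
    have mU: "t rA mod t rC \<le> U" using md C aU by linarith
    have L: "0 \<le> ?t rL" "?t rL < a\<^sub>0" unfolding rL using pos by auto
    have "\<bar>?t a\<bar> \<le> U" for a
    proof (cases "a \<in> {-6..-1}")
      case True
      then consider "a = rA" | "a = rC" | "a = rK" | "a = rL" | "a = rS" | "a = rV"
        by fastforce
      then show ?thesis
        by cases (use V L mU C q aU rA rC rK rS in simp_all)
    next
      case False
      then show ?thesis using rest t unfolding I_def bounded_def by metis
    qed
    then have b: "bounded U ?t" unfolding bounded_def by simp
    have dA: "a\<^sub>0 dvd t rA - t rK * c\<^sub>0" and dC: "a\<^sub>0 dvd t rC - t rL * c\<^sub>0"
      and g: "gcd (t rA) (t rC) = gcd a\<^sub>0 c\<^sub>0"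
      using t unfolding I_def by auto
    \<comment> \<open>The remainder inherits its congruence from the two old ones with the unreduced
      coefficient; \<open>d2\<close> then passes to the reduced one.\<close>
    have eq: "t rA mod t rC - (t rK - ?q * t rL) * c\<^sub>0
        = (t rA - t rK * c\<^sub>0) - ?q * (t rC - t rL * c\<^sub>0)"
      by (simp add: minus_div_mult_eq_mod[symmetric] algebra_simps)
    have d1: "a\<^sub>0 dvd t rA mod t rC - (t rK - ?q * t rL) * c\<^sub>0"
      unfolding eq by (rule dvd_diff[OF dA dvd_mult[OF dC]])
    have d2: "a\<^sub>0 dvd (t rK - ?q * t rL) - ?t rL"
      unfolding rL by (simp add: dvd_minus_mod)
    have eq2: "t rA mod t rC - ?t rL * c\<^sub>0 = (t rA mod t rC - (t rK - ?q * t rL) * c\<^sub>0)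
        + ((t rK - ?q * t rL) - ?t rL) * c\<^sub>0"
      by (simp add: algebra_simps)
    have d3: "a\<^sub>0 dvd ?t rC - ?t rL * c\<^sub>0"
      unfolding rC eq2 by (rule dvd_add[OF d1 dvd_mult2[OF d2]])
    have "gcd (t rC) (t rA mod t rC) = gcd a\<^sub>0 c\<^sub>0"
      using g by (metis gcd.commute gcd_red_int)
    moreover have "\<forall>a. a \<notin> {-6..-1} \<longrightarrow> ?t a = s a" using rest t unfolding I_def by simp
    ultimately have "I ?t"
      unfolding I_def using b md C L d3 dC by (simp only: rA rC rK) simp
    moreover have "f ?t < f t"
      unfolding f_def rA rC using C by (intro euclid_step_measure) auto
    ultimately show "I ?t \<and> f ?t < f t" ..
  qed
  define g where "g = (cost_factor (reg rC) + weight (reg rC)) * (bsize U)\<^sup>2"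
  have guard: "cost (reg rC) t + bsize (val (reg rC) t) \<le> g" if "I t" for t
    unfolding g_def by (rule guard_cost) (use that in \<open>simp add: I_def\<close>)
  have "f s \<le> 2 * bsize U"
    unfolding f_def using bsize_mult[of "s rA" "s rC"] bounded_bsize[OF U(1), of rA]
      bounded_bsize[OF U(1), of rC] by linarith
  from runs_to_WhilePos[of I "reg rC" g, OF guard body \<open>I s\<close> this]
  have "runs_to (euclid m) s (2 * bsize U * (block_factor (euclid_step m) * (bsize U)\<^sup>2 + g) + g)
      (\<lambda>s'. I s' \<and> \<not> val (reg rC) s' > 0)"
    unfolding euclid_def by simp
  then show ?thesis
  proof (rule runs_to_mono)
    have "1 \<le> bsize U" by (rule bsize_ge_1)
    then have "1 * g \<le> bsize U * g" by (intro mult_le_mono1)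
    then show "2 * bsize U * (block_factor (euclid_step m) * (bsize U)\<^sup>2 + g) + g
        \<le> euclid_factor m * bsize U ^ 3"
      unfolding euclid_factor_def g_def by (simp add: power2_eq_square power3_eq_cube algebra_simps)
  next
    fix s' assume *: "I s' \<and> \<not> val (reg rC) s' > 0"
    then have "s' rC = 0" "0 \<le> s' rA" unfolding I_def by auto
    then have "s' rA = gcd a\<^sub>0 c\<^sub>0" using * unfolding I_def by auto
    then show "bounded U s' \<and> (\<forall>a. a \<notin> {-6..-1} \<longrightarrow> s' a = s a) \<and> s' rA = gcd a\<^sub>0 c\<^sub>0 \<and>
      a\<^sub>0 dvd s' rA - s' rK * c\<^sub>0 \<and> 0 \<le> s' rK \<and> s' rK \<le> a\<^sub>0"
      using * unfolding I_def by simp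
  qed
qed

section \<open>Planar lattices in Hermite normal form\<close>

definition hnf_lattice :: "int \<Rightarrow> int \<Rightarrow> int \<Rightarrow> (int \<times> int) set" where
  "hnf_lattice p q r = {(a * p, a * q + c * r) | a c. True}"

definition adjoin :: "(int \<times> int) set \<Rightarrow> int \<Rightarrow> int \<Rightarrow> (int \<times> int) set" where
  "adjoin L x y = {(t\<^sub>1 + k * x, t\<^sub>2 + k * y) | t\<^sub>1 t\<^sub>2 k. (t\<^sub>1, t\<^sub>2) \<in> L}"

lemma hnf_latticeI: "t\<^sub>1 = a * p \<Longrightarrow> t\<^sub>2 = a * q + c * r \<Longrightarrow> (t\<^sub>1, t\<^sub>2) \<in> hnf_lattice p q r"
  unfolding hnf_lattice_def by blast

lemma hnf_latticeE:
  assumes "(t\<^sub>1, t\<^sub>2) \<in> hnf_lattice p q r"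
  obtains a c where "t\<^sub>1 = a * p" "t\<^sub>2 = a * q + c * r"
  using assms unfolding hnf_lattice_def by blast

lemma hnf_lattice_mod: "hnf_lattice p (q mod r) r = hnf_lattice p q r"
proof -
  have *: "q mod r = q - (q div r) * r" by (simp add: minus_div_mult_eq_mod)
  have "a * q + c * r = a * (q mod r) + (c + a * (q div r)) * r"
    "a * (q mod r) + c * r = a * q + (c - a * (q div r)) * r" for a c
    unfolding * by (simp_all add: algebra_simps)
  then show ?thesis unfolding hnf_lattice_def by (safe; blast)
qed

text \<open>The determinant of two lattice vectors is \<open>p * r\<close> times the determinant of
  their coordinates. It stands in for the theory of lattice indices.\<close>

lemma hnf_lattice_minor_dvd:
  assumes "(u\<^sub>1, u\<^sub>2) \<in> hnf_lattice p q r" "(v\<^sub>1, v\<^sub>2) \<in> hnf_lattice p q r"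
  shows "p * r dvd u\<^sub>1 * v\<^sub>2 - v\<^sub>1 * u\<^sub>2"
proof -
  obtain a c where u: "u\<^sub>1 = a * p" "u\<^sub>2 = a * q + c * r" using assms(1) by (rule hnf_latticeE)
  obtain b d where v: "v\<^sub>1 = b * p" "v\<^sub>2 = b * q + d * r" using assms(2) by (rule hnf_latticeE)
  have "u\<^sub>1 * v\<^sub>2 - v\<^sub>1 * u\<^sub>2 = (p * r) * (a * d - b * c)"
    unfolding u v by (simp add: algebra_simps)
  then show ?thesis by simp
qed

text \<open>The coefficient \<open>k\<close> of \<open>(x, y)\<close> modulo \<open>(p div g) * (r div r')\<close>, the index of the smaller
  lattice in the larger one, comes from writing \<open>(g, q')\<close> and \<open>(0, r')\<close> in terms of \<open>(p, q)\<close>,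
  \<open>(0, r)\<close> and \<open>(x, y)\<close>; their \<open>(x, y)\<close>-coefficients are \<open>\<beta>\<close> and \<open>- \<delta> * (p div g)\<close>.\<close>

lemma hnf_adjoin:
  fixes p q r x y \<beta> \<delta> :: int
  defines "g \<equiv> gcd p x" and "h \<equiv> (x * q - p * y) div gcd p x"
  defines "r' \<equiv> gcd r h" and "q' \<equiv> ((g - \<beta> * x) div p) * q + \<beta> * y"
  assumes "0 < p" "0 < r" and \<beta>: "p dvd g - \<beta> * x" and \<delta>: "r dvd r' - \<delta> * h"
  shows hnf_adjoin_eq: "adjoin (hnf_lattice p q r) x y = hnf_lattice g q' r'"
    and hnf_adjoin_coefficient: "(t\<^sub>1, t\<^sub>2) \<in> hnf_lattice g q' r' \<Longrightarrow>
      k = (t\<^sub>1 div g * \<beta> + (t\<^sub>2 - t\<^sub>1 div g * q') div r' * (- (\<delta> * (p div g))))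
        mod ((p div g) * (r div r')) \<Longrightarrow>
      (t\<^sub>1 - k * x, t\<^sub>2 - k * y) \<in> hnf_lattice p q r"
proof -
  have pos: "0 < g" "0 < r'" using assms(5,6) unfolding g_def r'_def by simp_all
  have "g dvd p" "g dvd x" unfolding g_def by simp_all
  then obtain P X where P: "p = g * P" and X: "x = g * X" by (elim dvdE) 
  \<comment> \<open>The combination \<open>X * (p, q) - P * (x, y)\<close> cancels the first
    coordinate and equals \<open>(0, h)\<close>. So \<open>(0, r)\<close> and \<open>(0, h)\<close>
    generate the vectors with first coordinate 0, which explains \<open>r' = gcd r h\<close>. From
    \<open>(0, r') = \<gamma> * (0, r) + \<delta> * (0, h)\<close> the vector \<open>(x, y)\<close>
    gets the coefficient \<open>- \<delta> * P\<close>.\<close>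
  have hh: "h = X * q - P * y"
  proof -
    have "x * q - p * y = g * (X * q - P * y)" unfolding P X by (simp add: algebra_simps)
    then show ?thesis unfolding h_def g_def[symmetric] using pos by simp
  qed
  obtain \<alpha> where \<alpha>: "g - \<beta> * x = p * \<alpha>" using \<beta> by (elim dvdE)
  have q': "q' = \<alpha> * q + \<beta> * y" unfolding q'_def \<alpha> using assms(5) by simp
  have "g * (\<alpha> * P + \<beta> * X) = g * 1" using \<alpha> unfolding P X by (simp add: algebra_simps)
  then have one: "\<alpha> * P + \<beta> * X = 1" using pos by simp
  have "r' dvd r" "r' dvd h" unfolding r'_def by simp_all
  then obtain R H where R: "r = r' * R" and H: "h = r' * H" by (elim dvdE)
  obtain \<gamma> where \<gamma>: "r' - \<delta> * h = r * \<gamma>" using \<delta> by (elim dvdE)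
  have quot: "p div g = P" "r div r' = R" using pos P R by simp_all

  have sub: "(t\<^sub>1 - k * x, t\<^sub>2 - k * y) \<in> hnf_lattice p q r"
    if t: "(t\<^sub>1, t\<^sub>2) \<in> hnf_lattice g q' r'"
      and k: "k = (t\<^sub>1 div g * \<beta> + (t\<^sub>2 - t\<^sub>1 div g * q') div r' * (- (\<delta> * (p div g))))
        mod ((p div g) * (r div r'))" for t\<^sub>1 t\<^sub>2 k
  proof -
    obtain m z where mz: "t\<^sub>1 = m * g" "t\<^sub>2 = m * q' + z * r'" using t by (rule hnf_latticeE)
    have mz': "t\<^sub>1 div g = m" "(t\<^sub>2 - m * q') div r' = z" unfolding mz using pos by simp_all
    define k\<^sub>0 where "k\<^sub>0 = m * \<beta> + z * (- (\<delta> * P))"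
    have "k = k\<^sub>0 mod (P * R)" unfolding k quot mz' k\<^sub>0_def ..
    then obtain e where e: "k = k\<^sub>0 - e * (P * R)"
      by (metis minus_div_mult_eq_mod)
    show ?thesis
    \<comment> \<open>The terms with \<open>e\<close> account for the reduction of
      \<open>k\<^sub>0\<close>: since \<open>R * h = H * r\<close>, one has
      \<open>P * R * (x, y) = R * X * (p, q) - H * (0, r)\<close>, which lies in the smaller
      lattice.\<close>
    proof (rule hnf_latticeI[where a = "m * \<alpha> + z * \<delta> * X + e * R * X"
          and c = "z * \<gamma> - e * H"])
      have "t\<^sub>1 - k * x - (m * \<alpha> + z * \<delta> * X + e * R * X) * p = m * g * (1 - (\<alpha> * P + \<beta> * X))"
        unfolding mz e k\<^sub>0_def P X by (simp add: algebra_simps)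
      then show "t\<^sub>1 - k * x = (m * \<alpha> + z * \<delta> * X + e * R * X) * p" unfolding one by simp
      have "t\<^sub>2 - k * y - ((m * \<alpha> + z * \<delta> * X + e * R * X) * q + (z * \<gamma> - e * H) * r)
          = z * (r' - \<delta> * (X * q - P * y) - r * \<gamma>) + e * (H * r - R * (X * q - P * y))"
        unfolding mz e k\<^sub>0_def q' by (simp add: algebra_simps)
      also have "\<dots> = 0" using \<gamma> unfolding hh[symmetric] H R by (simp add: algebra_simps)
      finally show "t\<^sub>2 - k * y = (m * \<alpha> + z * \<delta> * X + e * R * X) * q + (z * \<gamma> - e * H) * r"
        by simp
    qed
  qed
  then show "(t\<^sub>1, t\<^sub>2) \<in> hnf_lattice g q' r' \<Longrightarrow>
      k = (t\<^sub>1 div g * \<beta> + (t\<^sub>2 - t\<^sub>1 div g * q') div r' * (- (\<delta> * (p div g))))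
        mod ((p div g) * (r div r')) \<Longrightarrow>
      (t\<^sub>1 - k * x, t\<^sub>2 - k * y) \<in> hnf_lattice p q r" .

  show "adjoin (hnf_lattice p q r) x y = hnf_lattice g q' r'"
  proof (intro equalityI subsetI)
    fix t assume "t \<in> adjoin (hnf_lattice p q r) x y"
    then obtain t\<^sub>1 t\<^sub>2 k where t: "t = (t\<^sub>1 + k * x, t\<^sub>2 + k * y)" "(t\<^sub>1, t\<^sub>2) \<in> hnf_lattice p q r"
      unfolding adjoin_def by blast
    obtain a c where ac: "t\<^sub>1 = a * p" "t\<^sub>2 = a * q + c * r" using t(2) by (rule hnf_latticeE)
    show "t \<in> hnf_lattice g q' r'"
      unfolding t
    \<comment> \<open>Read off from \<open>(p, q) = P * (g, q') + \<beta> * H * (0, r')\<close>,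
      \<open>(x, y) = X * (g, q') - \<alpha> * H * (0, r')\<close> and
      \<open>(0, r) = R * (0, r')\<close>.\<close>
    proof (rule hnf_latticeI[where a = "a * P + k * X" and c = "(a * \<beta> - k * \<alpha>) * H + c * R"])
      show "t\<^sub>1 + k * x = (a * P + k * X) * g" unfolding ac P X by (simp add: algebra_simps)
      have "(a * P + k * X) * q' + ((a * \<beta> - k * \<alpha>) * H + c * R) * r'
          = (a * P + k * X) * (\<alpha> * q + \<beta> * y) + (a * \<beta> - k * \<alpha>) * h + c * r"
        unfolding q' R H by (simp add: algebra_simps)
      also have "\<dots> = a * q * (\<alpha> * P + \<beta> * X) + k * y * (\<alpha> * P + \<beta> * X) + c * r"
        unfolding hh by (simp add: algebra_simps)
      finally show "t\<^sub>2 + k * y = (a * P + k * X) * q' + ((a * \<beta> - k * \<alpha>) * H + c * R) * r'"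
        unfolding one ac by simp
    qed
  next
    fix t assume t: "t \<in> hnf_lattice g q' r'"
    obtain t\<^sub>1 t\<^sub>2 where tt: "t = (t\<^sub>1, t\<^sub>2)" by (cases t)
    define k where "k = (t\<^sub>1 div g * \<beta> + (t\<^sub>2 - t\<^sub>1 div g * q') div r' * (- (\<delta> * (p div g))))
        mod ((p div g) * (r div r'))"
    have "(t\<^sub>1 - k * x, t\<^sub>2 - k * y) \<in> hnf_lattice p q r"
      using sub[OF _ k_def] t unfolding tt by blast
    moreover have "t = ((t\<^sub>1 - k * x) + k * x, (t\<^sub>2 - k * y) + k * y)" unfolding tt by simp
    ultimately show "t \<in> adjoin (hnf_lattice p q r) x y" unfolding adjoin_def by blast
  qed
qed

section \<open>The solver\<close>

text \<open>The registers have negative addresses. The record of the column \<open>i\<close> occupies the eight cells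
  from \<open>8 * (n + i + 1)\<close> on, beyond the input. It contains a copy of the column, because the backward
  pass overwrites the input with the solution.\<close>

abbreviation (input) "rN \<equiv> - 7 :: int"
abbreviation (input) "rI \<equiv> - 8 :: int"
abbreviation (input) "rP \<equiv> - 9 :: int"
abbreviation (input) "rQ \<equiv> - 10 :: int"
abbreviation (input) "rR \<equiv> - 11 :: int"
abbreviation (input) "rX \<equiv> - 12 :: int"
abbreviation (input) "rY \<equiv> - 13 :: int"
abbreviation (input) "rG \<equiv> - 14 :: int"
abbreviation (input) "rF \<equiv> - 15 :: int"
abbreviation (input) "rT\<^sub>1 \<equiv> - 16 :: int"
abbreviation (input) "rT\<^sub>2 \<equiv> - 17 :: int"
abbreviation (input) "rU\<^sub>1 \<equiv> - 18 :: int"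
abbreviation (input) "rU\<^sub>2 \<equiv> - 19 :: int"
abbreviation (input) "rV\<^sub>1 \<equiv> - 20 :: int"
abbreviation (input) "rV\<^sub>2 \<equiv> - 21 :: int"
abbreviation (input) "rE \<equiv> - 22 :: int"
abbreviation (input) "rJ \<equiv> - 23 :: int"

abbreviation field :: "int \<Rightarrow> expr" where
  "field f \<equiv> Add (reg rJ) (Const f)"

abbreviation record_address :: expr where
  "record_address \<equiv> Mul (Const 8) (Add (Add (reg rN) (reg rI)) (Const 1))"

text \<open>Starting from \<open>(det B)\<^sup>2\<close> instead of \<open>\<bar>det B\<bar>\<close> avoids a case distinction on the sign.\<close>

definition init_block :: "(expr \<times> expr) list" where
  "init_block =
    [(Const rN, reg 0), (Const rT\<^sub>1, reg 1), (Const rT\<^sub>2, reg 2),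
     (Const rU\<^sub>1, reg 3), (Const rU\<^sub>2, reg 4), (Const rV\<^sub>1, reg 5), (Const rV\<^sub>2, reg 6),
     (Const rE, Sub (Mul (reg rU\<^sub>1) (reg rV\<^sub>2)) (Mul (reg rV\<^sub>1) (reg rU\<^sub>2))),
     (Const rP, Mul (reg rE) (reg rE)), (Const rQ, Const 0), (Const rR, Mul (reg rE) (reg rE)),
     (Const rI, Const 0)]"

definition read_block :: "(expr \<times> expr) list" where
  "read_block =
    [(Const rJ, record_address),
     (Const rX, Cell (Add (Const 3) (Mul (Const 2) (reg rI)))),
     (Const rY, Cell (Add (Const 4) (Mul (Const 2) (reg rI)))),
     (Const rA, reg rP), (Const rC, Mod (reg rX) (reg rP)), (Const rK, Const 0), (Const rL, Const 1)]"

definition middle_block :: "(expr \<times> expr) list" where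
  "middle_block =
    [(Const rG, reg rA), (Const rF, reg rK), (Const rA, reg rR),
     (Const rC, Mod (Div (Sub (Mul (reg rX) (reg rQ)) (Mul (reg rP) (reg rY))) (reg rG)) (reg rR)),
     (Const rK, Const 0), (Const rL, Const 1)]"

text \<open>In the notation of \<open>hnf_adjoin\<close>, the fields are \<open>x\<close>, \<open>y\<close>, \<open>g\<close>, \<open>q'\<close>, \<open>r'\<close>, \<open>\<beta>\<close>,
  \<open>- \<delta> * (p div g)\<close> and the index. The coefficient formula needs the unreduced \<open>q'\<close>; the register
  \<open>rQ\<close> receives \<open>q' mod r'\<close>, so that the numbers do not grow from column to column.\<close>

definition store_block :: "(expr \<times> expr) list" where
  "store_block =
    [(field 0, reg rX), (field 1, reg rY), (field 2, reg rG),
     (field 3, Add (Mul (Div (Sub (reg rG) (Mul (reg rF) (reg rX))) (reg rP)) (reg rQ))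
                 (Mul (reg rF) (reg rY))),
     (field 4, reg rA), (field 5, reg rF),
     (field 6, Sub (Const 0) (Mul (reg rK) (Div (reg rP) (reg rG)))),
     (field 7, Mul (Div (reg rP) (reg rG)) (Div (reg rR) (reg rA))),
     (Const rP, reg rG), (Const rQ, Mod (Cell (field 3)) (reg rA)), (Const rR, reg rA),
     (Const rI, Add (reg rI) (Const 1))]"

definition forward_body :: program where
  "forward_body = Seq (block read_block) (Seq (euclid rP)
     (Seq (block middle_block) (Seq (euclid rR) (block store_block))))"

definition backward_block :: "(expr \<times> expr) list" where
  "backward_block =
    [(Const rI, Sub (reg rI) (Const 1)),
     (Const rJ, record_address),
     (reg rI, Mod
        (Add (Mul (Div (reg rT\<^sub>1) (Cell (field 2))) (Cell (field 5)))
          (Mul (Div (Sub (reg rT\<^sub>2) (Mul (Div (reg rT\<^sub>1) (Cell (field 2))) (Cell (field 3))))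
                 (Cell (field 4)))
            (Cell (field 6))))
        (Cell (field 7))),
     (Const rT\<^sub>1, Sub (reg rT\<^sub>1) (Mul (Cell (reg rI)) (Cell (field 0)))),
     (Const rT\<^sub>2, Sub (reg rT\<^sub>2) (Mul (Cell (reg rI)) (Cell (field 1))))]"

definition final_block :: "(expr \<times> expr) list" where
  "final_block =
    [(Const 0, Div (Sub (Mul (reg rT\<^sub>1) (reg rV\<^sub>2)) (Mul (reg rV\<^sub>1) (reg rT\<^sub>2))) (reg rE)),
     (Const 1, Div (Sub (Mul (reg rU\<^sub>1) (reg rT\<^sub>2)) (Mul (reg rT\<^sub>1) (reg rU\<^sub>2))) (reg rE))]"

definition solver :: program where
  "solver = Seq (block init_block)
     (Seq (WhilePos (Sub (reg rN) (reg rI)) forward_body)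
       (Seq (WhilePos (Sub (reg rI) (Const 2)) (block backward_block)) (block final_block)))"

lemma bounded_upd: "bounded U s \<Longrightarrow> \<bar>x\<bar> \<le> U \<Longrightarrow> bounded U (s(a := x))"
  unfolding bounded_def by simp

section \<open>The chain of lattices and the invariant of the forward pass\<close>

locale column_system =
  fixes n :: nat and w\<^sub>1 w\<^sub>2 :: "nat \<Rightarrow> int" and b\<^sub>1 b\<^sub>2 Z :: int
  assumes two_le_n: "2 \<le> n" and n_le_Z: "int n \<le> Z"
    and w_le_Z: "\<And>i. i < n \<Longrightarrow> \<bar>w\<^sub>1 i\<bar> \<le> Z" "\<And>i. i < n \<Longrightarrow> \<bar>w\<^sub>2 i\<bar> \<le> Z"
    and b_le_Z: "\<bar>b\<^sub>1\<bar> \<le> Z" "\<bar>b\<^sub>2\<bar> \<le> Z"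
    and det_nz: "w\<^sub>1 0 * w\<^sub>2 1 - w\<^sub>1 1 * w\<^sub>2 0 \<noteq> 0"
    and det_le_Z: "(w\<^sub>1 0 * w\<^sub>2 1 - w\<^sub>1 1 * w\<^sub>2 0)\<^sup>2 \<le> Z"
begin

definition E :: int where "E = w\<^sub>1 0 * w\<^sub>2 1 - w\<^sub>1 1 * w\<^sub>2 0"

fun lat :: "nat \<Rightarrow> (int \<times> int) set" where
  "lat 0 = hnf_lattice (E * E) 0 (E * E)"
| "lat (Suc i) = adjoin (lat i) (w\<^sub>1 i) (w\<^sub>2 i)"

text \<open>The fourth power comes from the backward pass, where the current vector changes by at
  most \<open>Z ^ 3\<close> in each of at most \<open>Z\<close> steps. The factor 24 leaves room for
  lower powers of \<open>Z\<close> and for the record addresses.\<close>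

definition U :: int where "U = 24 * Z ^ 4"

definition addr :: "nat \<Rightarrow> int" where "addr i = 8 * (int n + int i + 1)"

definition index :: "memory \<Rightarrow> nat \<Rightarrow> int" where "index s i = s (addr i + 7)"

definition coefficient :: "memory \<Rightarrow> nat \<Rightarrow> int \<Rightarrow> int \<Rightarrow> int" where
  "coefficient s i t\<^sub>1 t\<^sub>2 =
     (t\<^sub>1 div s (addr i + 2) * s (addr i + 5)
       + (t\<^sub>2 - t\<^sub>1 div s (addr i + 2) * s (addr i + 3)) div s (addr i + 4) * s (addr i + 6))
     mod s (addr i + 7)"

text \<open>The bound \<open>Z * Z\<close> is only needed to keep the numbers of the backward pass polynomially long.\<close>

definition record_ok :: "memory \<Rightarrow> nat \<Rightarrow> bool" where
  "record_ok s i \<longleftrightarrow> s (addr i) = w\<^sub>1 i \<and> s (addr i + 1) = w\<^sub>2 i \<and> 0 < index s i \<and> index s i \<le> Z * Z \<and>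
     (\<forall>t\<^sub>1 t\<^sub>2. (t\<^sub>1, t\<^sub>2) \<in> lat (Suc i) \<longrightarrow>
       (t\<^sub>1 - coefficient s i t\<^sub>1 t\<^sub>2 * w\<^sub>1 i, t\<^sub>2 - coefficient s i t\<^sub>1 t\<^sub>2 * w\<^sub>2 i) \<in> lat i)"

lemma record_ok_cong:
  assumes "\<And>a. addr i \<le> a \<Longrightarrow> a < addr i + 8 \<Longrightarrow> s' a = s a"
  shows "record_ok s' i = record_ok s i" "index s' i = index s i"
proof -
  have eq: "s' (addr i) = s (addr i)" "s' (addr i + 1) = s (addr i + 1)"
    "s' (addr i + 2) = s (addr i + 2)" "s' (addr i + 3) = s (addr i + 3)"
    "s' (addr i + 4) = s (addr i + 4)" "s' (addr i + 5) = s (addr i + 5)"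
    "s' (addr i + 6) = s (addr i + 6)" "s' (addr i + 7) = s (addr i + 7)"
    by (auto intro!: assms)
  show "record_ok s' i = record_ok s i" "index s' i = index s i"
    unfolding record_ok_def index_def coefficient_def eq by simp_all
qed

definition loaded :: "memory \<Rightarrow> bool" where
  "loaded s \<longleftrightarrow> s rN = int n \<and> s rU\<^sub>1 = w\<^sub>1 0 \<and> s rU\<^sub>2 = w\<^sub>2 0 \<and> s rV\<^sub>1 = w\<^sub>1 1 \<and> s rV\<^sub>2 = w\<^sub>2 1 \<and> s rE = E"

text \<open>The divisibility by which the product of the indices is controlled starts at
  \<open>i = 2\<close>: the initial diagonal product \<open>E ^ 4\<close> need not divide
  \<open>E\<close>, and the indices of the two columns of \<open>B\<close> are not counted.\<close>

definition forward_inv :: "memory \<Rightarrow> nat \<Rightarrow> bool" where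
  "forward_inv s i \<longleftrightarrow> bounded U s \<and> loaded s \<and> s rI = int i \<and> i \<le> n \<and>
     s rT\<^sub>1 = b\<^sub>1 \<and> s rT\<^sub>2 = b\<^sub>2 \<and>
     (\<forall>j < n. s (3 + 2 * int j) = w\<^sub>1 j \<and> s (4 + 2 * int j) = w\<^sub>2 j) \<and>
     0 < s rP \<and> s rP \<le> Z \<and> 0 < s rR \<and> s rR \<le> Z \<and> 0 \<le> s rQ \<and> s rQ \<le> Z \<and>
     hnf_lattice (s rP) (s rQ) (s rR) = lat i \<and>
     (2 \<le> i \<longrightarrow> s rP * s rR * (\<Prod>j = 2..<i. index s j) dvd E) \<and>
     (\<forall>j < i. record_ok s j)"

lemma Z_pos: "2 \<le> Z"
  using two_le_n n_le_Z by linarith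

lemma Z_powers: "Z \<le> Z * Z" "Z * Z \<le> Z * Z * Z" "Z * Z * Z \<le> Z * Z * Z * Z" "1 \<le> Z"
proof -
  have *: "x \<le> x * Z" if "0 \<le> x" for x using Z_pos that mult_left_mono[of 1 Z x] by simp
  show "Z \<le> Z * Z" "Z * Z \<le> Z * Z * Z" "Z * Z * Z \<le> Z * Z * Z * Z" "1 \<le> Z"
    using *[of Z] *[of "Z * Z"] *[of "Z * Z * Z"] Z_pos by simp_all
qed

lemma U_eq: "U = 24 * (Z * Z * Z * Z)"
  unfolding U_def by (simp add: power4_eq_xxxx)

lemma E_le_Z: "E * E \<le> Z" "\<bar>E\<bar> \<le> Z" "E \<noteq> 0" "0 < E * E"
proof -
  show E: "E * E \<le> Z" "E \<noteq> 0" using det_le_Z det_nz unfolding E_def power2_eq_square by auto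
  then have "\<bar>E\<bar> * 1 \<le> \<bar>E\<bar> * \<bar>E\<bar>" by (intro mult_left_mono) auto
  then show "\<bar>E\<bar> \<le> Z" using E(1) by simp
  show "0 < E * E" using E(2) by (simp add: zero_less_mult_iff) linarith
qed

lemma columns_in_lat: "i < k \<Longrightarrow> (w\<^sub>1 i, w\<^sub>2 i) \<in> lat k"
proof (induction k)
  case (Suc k)
  have zero: "(0, 0) \<in> lat k" for k
  proof (induction k)
    case 0
    show ?case using hnf_latticeI[of 0 0 "E * E" 0 0 0 "E * E"] by simp
  next
    case (Suc k)
    have "(0, 0) = (0 + 0 * w\<^sub>1 k, 0 + 0 * w\<^sub>2 k)" by simp
    then show ?case using Suc unfolding lat.simps adjoin_def by blast
  qed
  show ?case
  proof (cases "i = k")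
    case True
    have "(w\<^sub>1 i, w\<^sub>2 i) = (0 + 1 * w\<^sub>1 k, 0 + 1 * w\<^sub>2 k)" using True by simp
    then show ?thesis using zero[of k] unfolding lat.simps adjoin_def by blast
  next
    case False
    then have "(w\<^sub>1 i, w\<^sub>2 i) \<in> lat k" using Suc by simp
    moreover have "(w\<^sub>1 i, w\<^sub>2 i) = (w\<^sub>1 i + 0 * w\<^sub>1 k, w\<^sub>2 i + 0 * w\<^sub>2 k)" by simp
    ultimately show ?thesis unfolding lat.simps adjoin_def by blast
  qed
qed simp

lemma lat_2E:
  assumes "(t\<^sub>1, t\<^sub>2) \<in> lat 2"
  obtains d\<^sub>1 d\<^sub>2 k\<^sub>0 k\<^sub>1 where "t\<^sub>1 = E * E * d\<^sub>1 + k\<^sub>0 * w\<^sub>1 0 + k\<^sub>1 * w\<^sub>1 1"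
    "t\<^sub>2 = E * E * d\<^sub>2 + k\<^sub>0 * w\<^sub>2 0 + k\<^sub>1 * w\<^sub>2 1"
proof -
  have "lat 2 = adjoin (adjoin (lat 0) (w\<^sub>1 0) (w\<^sub>2 0)) (w\<^sub>1 1) (w\<^sub>2 1)"
    by (simp add: numeral_2_eq_2)
  then obtain a c k k' where "t\<^sub>1 = a * (E * E) + k * w\<^sub>1 0 + k' * w\<^sub>1 1"
    "t\<^sub>2 = c * (E * E) + k * w\<^sub>2 0 + k' * w\<^sub>2 1"
    using assms unfolding adjoin_def lat.simps(1) hnf_lattice_def by auto
  then show ?thesis using that[of a k k' c] by (simp add: mult_ac)
qed

text \<open>The divisions are exact on \<open>lat 2\<close>: its vectors are integer combinations of
  the two columns of \<open>B\<close> up to a multiple of \<open>E * E\<close>, so \<open>E\<close>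
  divides both numerators.\<close>

lemma cramer:
  fixes t\<^sub>1 t\<^sub>2
  assumes "(t\<^sub>1, t\<^sub>2) \<in> lat 2"
  defines "x\<^sub>0 \<equiv> (t\<^sub>1 * w\<^sub>2 1 - w\<^sub>1 1 * t\<^sub>2) div E" and "x\<^sub>1 \<equiv> (w\<^sub>1 0 * t\<^sub>2 - t\<^sub>1 * w\<^sub>2 0) div E"
  shows "E * x\<^sub>0 = t\<^sub>1 * w\<^sub>2 1 - w\<^sub>1 1 * t\<^sub>2" "E * x\<^sub>1 = w\<^sub>1 0 * t\<^sub>2 - t\<^sub>1 * w\<^sub>2 0"
    "x\<^sub>0 * w\<^sub>1 0 + x\<^sub>1 * w\<^sub>1 1 = t\<^sub>1" "x\<^sub>0 * w\<^sub>2 0 + x\<^sub>1 * w\<^sub>2 1 = t\<^sub>2"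
proof -
  obtain d\<^sub>1 d\<^sub>2 k\<^sub>0 k\<^sub>1 where t: "t\<^sub>1 = E * E * d\<^sub>1 + k\<^sub>0 * w\<^sub>1 0 + k\<^sub>1 * w\<^sub>1 1"
    "t\<^sub>2 = E * E * d\<^sub>2 + k\<^sub>0 * w\<^sub>2 0 + k\<^sub>1 * w\<^sub>2 1"
    using lat_2E[OF assms(1)] .
  have "t\<^sub>1 * w\<^sub>2 1 - w\<^sub>1 1 * t\<^sub>2 = E * (E * (d\<^sub>1 * w\<^sub>2 1 - w\<^sub>1 1 * d\<^sub>2) + k\<^sub>0)"
    "w\<^sub>1 0 * t\<^sub>2 - t\<^sub>1 * w\<^sub>2 0 = E * (E * (w\<^sub>1 0 * d\<^sub>2 - d\<^sub>1 * w\<^sub>2 0) + k\<^sub>1)"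
    unfolding t by (simp_all add: algebra_simps E_def)
  then show 0: "E * x\<^sub>0 = t\<^sub>1 * w\<^sub>2 1 - w\<^sub>1 1 * t\<^sub>2" "E * x\<^sub>1 = w\<^sub>1 0 * t\<^sub>2 - t\<^sub>1 * w\<^sub>2 0"
    unfolding x\<^sub>0_def x\<^sub>1_def using E_le_Z by simp_all
  have "E * (x\<^sub>0 * w\<^sub>1 0 + x\<^sub>1 * w\<^sub>1 1) = (E * x\<^sub>0) * w\<^sub>1 0 + (E * x\<^sub>1) * w\<^sub>1 1"
    "E * (x\<^sub>0 * w\<^sub>2 0 + x\<^sub>1 * w\<^sub>2 1) = (E * x\<^sub>0) * w\<^sub>2 0 + (E * x\<^sub>1) * w\<^sub>2 1"
    by (simp_all add: algebra_simps)
  then have "E * (x\<^sub>0 * w\<^sub>1 0 + x\<^sub>1 * w\<^sub>1 1) = E * t\<^sub>1" "E * (x\<^sub>0 * w\<^sub>2 0 + x\<^sub>1 * w\<^sub>2 1) = E * t\<^sub>2"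
    unfolding 0 by (simp_all add: algebra_simps E_def)
  then show "x\<^sub>0 * w\<^sub>1 0 + x\<^sub>1 * w\<^sub>1 1 = t\<^sub>1" "x\<^sub>0 * w\<^sub>2 0 + x\<^sub>1 * w\<^sub>2 1 = t\<^sub>2"
    using E_le_Z by simp_all
qed

definition input :: "memory \<Rightarrow> bool" where
  "input s \<longleftrightarrow> bounded Z s \<and> s 0 = int n \<and> s 1 = b\<^sub>1 \<and> s 2 = b\<^sub>2 \<and>
     (\<forall>j < n. s (3 + 2 * int j) = w\<^sub>1 j \<and> s (4 + 2 * int j) = w\<^sub>2 j)"

lemma forward_inv_init:
  assumes "input s"
  shows "forward_inv (effect init_block s) 0"
proof -
  have s: "s 0 = int n" "s 1 = b\<^sub>1" "s 2 = b\<^sub>2" "s 3 = w\<^sub>1 0" "s 4 = w\<^sub>2 0" "s 5 = w\<^sub>1 1" "s 6 = w\<^sub>2 1"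
    using assms two_le_n unfolding input_def
    by (force dest: spec[of _ "0::nat"] spec[of _ "1::nat"])+
  have eff: "effect init_block s = s(rN := int n, rT\<^sub>1 := b\<^sub>1, rT\<^sub>2 := b\<^sub>2, rU\<^sub>1 := w\<^sub>1 0, rU\<^sub>2 := w\<^sub>2 0,
     rV\<^sub>1 := w\<^sub>1 1, rV\<^sub>2 := w\<^sub>2 1, rE := E, rP := E * E, rQ := 0, rR := E * E, rI := 0)"
    unfolding init_block_def E_def by (simp add: s)
  have ZU: "Z \<le> U" unfolding U_eq using Z_powers by linarith
  then have "bounded U s" using assms unfolding input_def bounded_def by (meson order_trans)
  then have "bounded U (effect init_block s)"
    unfolding eff using ZU b_le_Z w_le_Z[of 0] w_le_Z[of 1] E_le_Z n_le_Z two_le_n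
    by (intro bounded_upd) auto
  then show ?thesis
    unfolding forward_inv_def loaded_def
    using assms E_le_Z Z_pos unfolding input_def by (simp add: eff)
qed

end

section \<open>One forward step: adjoining a column\<close>

lemma runs_to_block_cubic:
  assumes "bounded U s" "effect xs s = s'"
  shows "runs_to (block xs) s (block_factor xs * bsize U ^ 3) (\<lambda>t. t = s')"
proof -
  have "block_factor xs * (bsize U)\<^sup>2 \<le> block_factor xs * bsize U ^ 3"
    using bsize_ge_1[of U] by (intro mult_le_mono2 power_increasing) auto
  with runs_to_block[OF assms(1), of "\<lambda>t. t = s'" xs] assms(2) show ?thesis
    by (auto intro: runs_to_mono)
qed

lemma abs_mult_mono: "\<bar>a\<bar> \<le> A \<Longrightarrow> \<bar>b\<bar> \<le> B \<Longrightarrow> \<bar>a * b\<bar> \<le> A * (B :: int)"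
  unfolding abs_mult by (intro mult_mono) auto

definition forward_factor :: nat where
  "forward_factor = block_factor read_block + (euclid_factor rP + (block_factor middle_block +
     (euclid_factor rR + block_factor store_block)))"

context column_system
begin

lemma forward_step:
  assumes inv: "forward_inv s i" and i: "i < n"
  shows "runs_to forward_body s (forward_factor * bsize U ^ 3) (\<lambda>s'. forward_inv s' (Suc i))"
proof -
  define p q r x y J where "p = s rP" and "q = s rQ" and "r = s rR" and "x = w\<^sub>1 i" and "y = w\<^sub>2 i"
    and "J = addr i"
  note defs = p_def q_def r_def x_def y_def
  have s: "bounded U s" "s rN = int n" "s rI = int i" "s (3 + 2 * int i) = x" "s (4 + 2 * int i) = y"
    and p: "0 < p" "p \<le> Z" and r: "0 < r" "r \<le> Z" and q: "0 \<le> q" "q \<le> Z"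
    and lat: "hnf_lattice p q r = lat i"
    and prod: "2 \<le> i \<Longrightarrow> p * r * (\<Prod>j = 2..<i. index s j) dvd E"
    using inv i unfolding forward_inv_def loaded_def defs by auto
  have xy: "\<bar>x\<bar> \<le> Z" "\<bar>y\<bar> \<le> Z" unfolding x_def y_def using w_le_Z i by auto
  have "8 * (int n + int i + 1) \<le> 24 * Z" using i n_le_Z by simp
  moreover have "Z \<le> Z * Z * Z * Z" using Z_powers by linarith
  ultimately have "8 * (int n + int i + 1) \<le> 24 * (Z * Z * Z * Z)" by linarith
  then have J: "J = 8 * (int n + int i + 1)" "0 < J" "J \<le> U"
    unfolding J_def addr_def U_eq by simp_all
  have ZU: "Z \<le> U" "1 \<le> U" unfolding U_eq using Z_powers by linarith+
  have square: "a * a + a \<le> U" if "0 < a" "a \<le> Z" for a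
  proof -
    have "a * a \<le> Z * Z" using that by (intro mult_mono) auto
    then show ?thesis unfolding U_eq using Z_powers that by linarith
  qed

  define s\<^sub>1 where "s\<^sub>1 = s(rJ := J, rX := x, rY := y, rA := p, rC := x mod p, rK := 0, rL := 1)"
  have "effect read_block s = s\<^sub>1"
    unfolding read_block_def s\<^sub>1_def using s J by (simp add: minus_div_mult_eq_mod p_def)
  then have 1: "runs_to (block read_block) s (block_factor read_block * bsize U ^ 3) (\<lambda>t. t = s\<^sub>1)"
    by (rule runs_to_block_cubic[OF s(1)])
  have "0 \<le> x mod p" "x mod p < p" using p by auto
  then have b1: "bounded U s\<^sub>1"
    unfolding s\<^sub>1_def using s(1) xy p J ZU by (intro bounded_upd) linarith+
  have 2: "runs_to (euclid rP) s\<^sub>1 (euclid_factor rP * bsize U ^ 3)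
    (\<lambda>t. bounded U t \<and> (\<forall>a. a \<notin> {-6..-1} \<longrightarrow> t a = s\<^sub>1 a) \<and> t rA = gcd p (x mod p) \<and>
      p dvd t rA - t rK * (x mod p) \<and> 0 \<le> t rK \<and> t rK \<le> p)"
    using runs_to_euclid[of rP s\<^sub>1 U] p b1 square[OF p] by (simp add: s\<^sub>1_def p_def)

  define g h r' where "g = gcd p x" and "h = (x * q - p * y) div g" and "r' = gcd r h"
  \<comment> \<open>The Euclidean loop wants its second number nonnegative and below the first, so
    it is run on residues. This changes neither the gcds nor the validity of the coefficients, as
    \<open>\<beta>_dvd\<close> and \<open>\<delta>_dvd\<close> confirm below.\<close>
  have gcd_p: "gcd p (x mod p) = g" and gcd_r: "gcd r (h mod r) = r'"
    unfolding g_def r'_def by (metis gcd.commute gcd_red_int)+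
  have g: "0 < g" "g \<le> p" unfolding g_def using p by (auto intro: zdvd_imp_le)
  have r': "0 < r'" "r' \<le> r" unfolding r'_def using r by (auto intro: zdvd_imp_le)

  have rest: "runs_to (Seq (block middle_block) (Seq (euclid rR) (block store_block))) s\<^sub>2
      ((block_factor middle_block + (euclid_factor rR + block_factor store_block)) * bsize U ^ 3)
      (\<lambda>s'. forward_inv s' (Suc i))"
    if "bounded U s\<^sub>2 \<and> (\<forall>a. a \<notin> {-6..-1} \<longrightarrow> s\<^sub>2 a = s\<^sub>1 a) \<and> s\<^sub>2 rA = gcd p (x mod p) \<and>
      p dvd s\<^sub>2 rA - s\<^sub>2 rK * (x mod p) \<and> 0 \<le> s\<^sub>2 rK \<and> s\<^sub>2 rK \<le> p" for s\<^sub>2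
  proof -
    define \<beta> where "\<beta> = s\<^sub>2 rK"
    have b2: "bounded U s\<^sub>2" and agree2: "\<And>a. a \<notin> {-6..-1} \<Longrightarrow> s\<^sub>2 a = s\<^sub>1 a" and s2A: "s\<^sub>2 rA = g"
      and dvd: "p dvd g - \<beta> * (x mod p)" and \<beta>: "0 \<le> \<beta>" "\<beta> \<le> p"
      using that unfolding \<beta>_def by (auto simp: gcd_p)
    have \<beta>_dvd: "p dvd g - \<beta> * x"
    proof -
      have "g - \<beta> * x = (g - \<beta> * (x mod p)) - p * (\<beta> * (x div p))"
        by (simp add: minus_div_mult_eq_mod[symmetric] algebra_simps)
      then show ?thesis using dvd by (metis dvd_diff dvd_triv_left)
    qed
    define s\<^sub>3 where "s\<^sub>3 = s\<^sub>2(rG := g, rF := \<beta>, rA := r, rC := h mod r, rK := 0, rL := 1)"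
    have "effect middle_block s\<^sub>2 = s\<^sub>3"
      unfolding middle_block_def s\<^sub>3_def h_def
      by (simp add: agree2 s2A minus_div_mult_eq_mod \<beta>_def s\<^sub>1_def flip: p_def q_def r_def)
    then have 3: "runs_to (block middle_block) s\<^sub>2 (block_factor middle_block * bsize U ^ 3) (\<lambda>t. t = s\<^sub>3)"
      by (rule runs_to_block_cubic[OF b2])
    have "0 \<le> h mod r" "h mod r < r" using r by auto
    then have b3: "bounded U s\<^sub>3"
      unfolding s\<^sub>3_def using b2 g \<beta> p r ZU by (intro bounded_upd) linarith+
    have s3R: "s\<^sub>3 rR = r" unfolding s\<^sub>3_def s\<^sub>1_def by (simp add: agree2 s\<^sub>1_def r_def)
    have 4: "runs_to (euclid rR) s\<^sub>3 (euclid_factor rR * bsize U ^ 3)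
      (\<lambda>t. bounded U t \<and> (\<forall>a. a \<notin> {-6..-1} \<longrightarrow> t a = s\<^sub>3 a) \<and> t rA = gcd r (h mod r) \<and>
        r dvd t rA - t rK * (h mod r) \<and> 0 \<le> t rK \<and> t rK \<le> r)"
      using runs_to_euclid[of rR s\<^sub>3 U] r b3 square[OF r] unfolding s3R by (simp add: s\<^sub>3_def)

    have last: "runs_to (block store_block) s\<^sub>4 (block_factor store_block * bsize U ^ 3)
        (\<lambda>s'. forward_inv s' (Suc i))"
      if "bounded U s\<^sub>4 \<and> (\<forall>a. a \<notin> {-6..-1} \<longrightarrow> s\<^sub>4 a = s\<^sub>3 a) \<and> s\<^sub>4 rA = gcd r (h mod r) \<and>
        r dvd s\<^sub>4 rA - s\<^sub>4 rK * (h mod r) \<and> 0 \<le> s\<^sub>4 rK \<and> s\<^sub>4 rK \<le> r" for s\<^sub>4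
    proof -
      define \<delta> where "\<delta> = s\<^sub>4 rK"
      have b4: "bounded U s\<^sub>4" and agree4: "\<And>a. a \<notin> {-6..-1} \<Longrightarrow> s\<^sub>4 a = s\<^sub>3 a" and s4A: "s\<^sub>4 rA = r'"
        and dvd: "r dvd r' - \<delta> * (h mod r)" and \<delta>: "0 \<le> \<delta>" "\<delta> \<le> r"
        using that unfolding \<delta>_def by (auto simp: gcd_r)
      have \<delta>_dvd: "r dvd r' - \<delta> * h"
      proof -
        have "r' - \<delta> * h = (r' - \<delta> * (h mod r)) - r * (\<delta> * (h div r))"
          by (simp add: minus_div_mult_eq_mod[symmetric] algebra_simps)
        then show ?thesis using dvd by (metis dvd_diff dvd_triv_left)
      qed
      define q' where "q' = ((g - \<beta> * x) div p) * q + \<beta> * y"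
      define c where "c = (p div g) * (r div r')"
      define s\<^sub>5 where "s\<^sub>5 = s\<^sub>4(J := x, J + 1 := y, J + 2 := g, J + 3 := q', J + 4 := r', J + 5 := \<beta>,
        J + 6 := - (\<delta> * (p div g)), J + 7 := c, rP := g, rQ := q' mod r', rR := r', rI := int i + 1)"
      have regs4: "s\<^sub>4 rJ = J" "s\<^sub>4 rX = x" "s\<^sub>4 rY = y" "s\<^sub>4 rG = g" "s\<^sub>4 rP = p" "s\<^sub>4 rQ = q"
        "s\<^sub>4 rR = r" "s\<^sub>4 rF = \<beta>" "s\<^sub>4 rI = int i"
        by (simp_all add: agree4 agree2 s\<^sub>3_def s\<^sub>1_def p_def q_def r_def s)
      have store: "effect store_block s\<^sub>4 = s\<^sub>5"
        unfolding store_block_def s\<^sub>5_def q'_def c_def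
        using J(2) by (simp add: regs4 s4A minus_div_mult_eq_mod flip: \<delta>_def)
      have other: "s\<^sub>5 a = s a" if "a \<notin> {-6..-1}" "a \<notin> {rP, rQ, rR, rI, rG, rF, rX, rY, rJ}"
        "a < J \<or> J + 8 \<le> a" for a
      proof -
        have "a \<noteq> J" "a \<noteq> J + 1" "a \<noteq> J + 2" "a \<noteq> J + 3" "a \<noteq> J + 4" "a \<noteq> J + 5" "a \<noteq> J + 6"
          "a \<noteq> J + 7"
          using that(3) by auto
        then have "s\<^sub>5 a = s\<^sub>4 a" using that(2) by (simp add: s\<^sub>5_def)
        moreover have "a \<noteq> rA" "a \<noteq> rC" "a \<noteq> rK" "a \<noteq> rL" using that(1) by auto
        ultimately show ?thesis
          using that(2) by (simp add: agree4[OF that(1)] agree2[OF that(1)] s\<^sub>3_def s\<^sub>1_def)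
      qed
      have q'_le: "\<bar>q'\<bar> \<le> U"
      proof -
        have "\<bar>\<beta> * x\<bar> \<le> Z * Z" "\<bar>\<beta> * y\<bar> \<le> Z * Z"
          using \<beta> p xy by (intro abs_mult_mono; simp)+
        moreover have "\<bar>(g - \<beta> * x) div p\<bar> \<le> \<bar>g - \<beta> * x\<bar>" by (rule abs_div_le)
        ultimately have "\<bar>(g - \<beta> * x) div p\<bar> \<le> 2 * (Z * Z)" using g p Z_powers by linarith
        then have "\<bar>((g - \<beta> * x) div p) * q\<bar> \<le> 2 * (Z * Z) * Z"
          using q by (intro abs_mult_mono) auto
        also have "2 * (Z * Z) * Z = 2 * (Z * Z * Z)" by simp
        finally show ?thesis
          using \<open>\<bar>\<beta> * y\<bar> \<le> Z * Z\<close> Z_powers unfolding q'_def U_eq by linarith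
      qed
      have quot: "0 < p div g" "p div g \<le> Z" "0 < r div r'" "r div r' \<le> Z"
        using g r' p r zdiv_mono2[of p 1 g] zdiv_mono2[of r 1 r'] by (auto simp: pos_imp_zdiv_pos_iff)
      have "0 < c" unfolding c_def using quot by simp
      have "\<bar>c\<bar> \<le> Z * Z" unfolding c_def using quot by (intro abs_mult_mono) auto
      then have "c \<le> Z * Z" by simp
      have "\<bar>\<delta> * (p div g)\<bar> \<le> Z * Z" using \<delta> r quot by (intro abs_mult_mono) auto
      then have \<delta>_le: "\<bar>- (\<delta> * (p div g))\<bar> \<le> U" unfolding U_eq using Z_powers by linarith
      have c_le: "\<bar>c\<bar> \<le> U" using \<open>\<bar>c\<bar> \<le> Z * Z\<close> unfolding U_eq using Z_powers by linarith
      have "0 \<le> q' mod r'" "q' mod r' < r'" using r' by simp_all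
      then have qm: "0 \<le> q' mod r'" "q' mod r' \<le> Z" using r' r by linarith+
      have b5: "bounded U s\<^sub>5"
        unfolding s\<^sub>5_def
        by (intro bounded_upd b4 q'_le \<delta>_le c_le; use xy g p r' r \<beta> qm ZU n_le_Z i in linarith)

      have adj: "lat (Suc i) = hnf_lattice g q' r'"
        unfolding lat.simps lat[symmetric] x_def[symmetric] y_def[symmetric] q'_def r'_def h_def g_def
        by (rule hnf_adjoin_eq[OF p(1) r(1) \<beta>_dvd[unfolded g_def] \<delta>_dvd[unfolded r'_def h_def g_def]])
      have index: "index s\<^sub>5 i = c"
        unfolding index_def J_def[symmetric] s\<^sub>5_def using J by simp
      have rec: "record_ok s\<^sub>5 i"
        unfolding record_ok_def index coefficient_def J_def[symmetric] adj lat[symmetric]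
          x_def[symmetric] y_def[symmetric]
      proof (intro conjI allI impI)
        fix t\<^sub>1 t\<^sub>2
        assume t: "(t\<^sub>1, t\<^sub>2) \<in> hnf_lattice g q' r'"
        define k where "k = (t\<^sub>1 div s\<^sub>5 (J + 2) * s\<^sub>5 (J + 5) + (t\<^sub>2 - t\<^sub>1 div s\<^sub>5 (J + 2) * s\<^sub>5 (J + 3))
          div s\<^sub>5 (J + 4) * s\<^sub>5 (J + 6)) mod s\<^sub>5 (J + 7)"
        have "k = (t\<^sub>1 div g * \<beta> + (t\<^sub>2 - t\<^sub>1 div g * q') div r' * (- (\<delta> * (p div g))))
          mod ((p div g) * (r div r'))"
          unfolding k_def c_def[symmetric] s\<^sub>5_def using J by simp
        then show "(t\<^sub>1 - k * x, t\<^sub>2 - k * y) \<in> hnf_lattice p q r"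
          using t unfolding q'_def r'_def h_def g_def
          by (intro hnf_adjoin_coefficient[OF p(1) r(1) \<beta>_dvd[unfolded g_def]
                \<delta>_dvd[unfolded r'_def h_def g_def]])
      qed (use J \<open>0 < c\<close> \<open>c \<le> Z * Z\<close> in \<open>simp_all add: s\<^sub>5_def\<close>)
      have old: "record_ok s\<^sub>5 j" "index s\<^sub>5 j = index s j" if "j < i" for j
      proof -
        have "s\<^sub>5 a = s a" if "addr j \<le> a" "a < addr j + 8" for a
          using that \<open>j < i\<close> by (intro other) (auto simp: J_def addr_def)
        from record_ok_cong[OF this] show "record_ok s\<^sub>5 j" "index s\<^sub>5 j = index s j"
          using inv that unfolding forward_inv_def by auto
      qed
      \<comment> \<open>For \<open>i = 1\<close> the product is empty and the claim is new: both
        columns of \<open>B\<close> lie in \<open>lat 2\<close>, and their determinant is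
        \<open>E\<close>. From then on \<open>p * r = g * r' * c\<close> merely moves the factor
        \<open>c\<close> from the diagonal into the product of the indices.\<close>
      have prod': "g * r' * (\<Prod>j = 2..<Suc i. index s\<^sub>5 j) dvd E" if "2 \<le> Suc i"
      proof (cases "i = 1")
        case True
        have "g * r' dvd w\<^sub>1 0 * w\<^sub>2 1 - w\<^sub>1 1 * w\<^sub>2 0"
          by (intro hnf_lattice_minor_dvd[of _ _ _ q'])
            (use columns_in_lat[of 0 "Suc i"] columns_in_lat[of 1 "Suc i"] True adj in auto)
        then show ?thesis using True by (simp add: E_def)
      next
        case False
        then have "2 \<le> i" using that by simp
        have "p = g * (p div g)" "r = r' * (r div r')" unfolding g_def r'_def by simp_all
        then have "p * r = g * r' * c" unfolding c_def by (metis mult.assoc mult.left_commute)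
        moreover have "(\<Prod>j = 2..<i. index s\<^sub>5 j) = (\<Prod>j = 2..<i. index s j)"
          using old by (intro prod.cong) auto
        ultimately show ?thesis
          using prod[OF \<open>2 \<le> i\<close>] \<open>2 \<le> i\<close> index by (simp add: mult_ac)
      qed
      have regs5: "s\<^sub>5 rP = g" "s\<^sub>5 rQ = q' mod r'" "s\<^sub>5 rR = r'" "s\<^sub>5 rI = int i + 1"
        unfolding s\<^sub>5_def by simp_all
      have "loaded s\<^sub>5" using inv J(2) unfolding forward_inv_def loaded_def by (simp add: other)
      moreover have "s\<^sub>5 rT\<^sub>1 = b\<^sub>1" "s\<^sub>5 rT\<^sub>2 = b\<^sub>2"
        using inv J(2) unfolding forward_inv_def by (simp_all add: other)
      moreover have "s\<^sub>5 (3 + 2 * int j) = w\<^sub>1 j" "s\<^sub>5 (4 + 2 * int j) = w\<^sub>2 j" if "j < n" for j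
        using that inv J(1) unfolding forward_inv_def by (simp_all add: other)
      ultimately have "forward_inv s\<^sub>5 (Suc i)"
        unfolding forward_inv_def regs5 hnf_lattice_mod adj
        using b5 i g p r' r qm prod' rec old by (auto simp: less_Suc_eq)
      then show ?thesis
        using runs_to_block_cubic[OF b4 store] by (auto intro: runs_to_mono)
    qed
    have "runs_to (Seq (euclid rR) (block store_block)) s\<^sub>3
        ((euclid_factor rR + block_factor store_block) * bsize U ^ 3) (\<lambda>s'. forward_inv s' (Suc i))"
      unfolding add_mult_distrib by (rule runs_to_Seq[OF 4]) (rule last)
    then show ?thesis
      unfolding add_mult_distrib[of "block_factor middle_block"]
      by (intro runs_to_Seq[OF 3]) (simp only:)
  qed
  have "runs_to (Seq (euclid rP) (Seq (block middle_block) (Seq (euclid rR) (block store_block)))) s\<^sub>1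
      ((euclid_factor rP + (block_factor middle_block + (euclid_factor rR + block_factor store_block)))
        * bsize U ^ 3) (\<lambda>s'. forward_inv s' (Suc i))"
    unfolding add_mult_distrib[of "euclid_factor rP"] by (rule runs_to_Seq[OF 2]) (rule rest)
  then show ?thesis
    unfolding forward_body_def forward_factor_def add_mult_distrib[of "block_factor read_block"]
    by (intro runs_to_Seq[OF 1]) (simp only:)
qed

end

section \<open>The backward pass and the solution that it leaves\<close>

text \<open>The induction step is \<open>(a - 1) * (b - 1) \<ge> 0\<close>, that is,
  \<open>(a - 1) + (b - 1) \<le> a * b - 1\<close>.\<close>

lemma sum_minus_1_le_prod_minus_1:
  fixes f :: "'a \<Rightarrow> int"
  assumes "finite A" "\<And>j. j \<in> A \<Longrightarrow> 1 \<le> f j"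
  shows "1 \<le> prod f A \<and> (\<Sum>j\<in>A. f j - 1) \<le> prod f A - 1"
  using assms
proof (induction A rule: finite_induct)
  case (insert a A)
  have "1 \<le> f a" "1 \<le> prod f A" "(\<Sum>j\<in>A. f j - 1) \<le> prod f A - 1" using insert by auto
  moreover from this have "0 \<le> (f a - 1) * (prod f A - 1)" "1 * 1 \<le> f a * prod f A"
    by (simp, intro mult_mono) auto
  ultimately show ?case using insert by (simp add: algebra_simps)
qed simp

lemma guard_cost_cubic:
  assumes "bounded U s"
  shows "cost e s + bsize (val e s) \<le> (cost_factor e + weight e) * bsize U ^ 3"
proof -
  have "(cost_factor e + weight e) * (bsize U)\<^sup>2 \<le> (cost_factor e + weight e) * bsize U ^ 3"
    using bsize_ge_1[of U] by (intro mult_le_mono2 power_increasing) auto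
  with guard_cost[OF assms, of e] show ?thesis by linarith
qed

abbreviation forward_guard :: expr where
  "forward_guard \<equiv> Sub (reg rN) (reg rI)"

abbreviation backward_guard :: expr where
  "backward_guard \<equiv> Sub (reg rI) (Const 2)"

definition solver_factor :: nat where
  "solver_factor = block_factor init_block
     + (forward_factor + (cost_factor forward_guard + weight forward_guard))
     + (block_factor backward_block + (cost_factor backward_guard + weight backward_guard))
     + block_factor final_block"

locale solvable_system = column_system +
  assumes minors: "\<And>d. (\<And>i j. i < j \<Longrightarrow> j < n \<Longrightarrow> d dvd w\<^sub>1 i * w\<^sub>2 j - w\<^sub>1 j * w\<^sub>2 i) \<Longrightarrow> d dvd 1"
    \<comment> \<open>the two \<open>B\<close>-coordinates of what remains of \<open>b\<close>, scaled by \<open>(det B)\<^sup>2\<close>\<close>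
    and nonneg: "\<And>k. (\<And>j. 0 \<le> k j) \<Longrightarrow> (\<Sum>j = 2..<n. k j) \<le> \<bar>E\<bar> - 1 \<Longrightarrow>
        0 \<le> E * ((b\<^sub>1 - (\<Sum>j = 2..<n. k j * w\<^sub>1 j)) * w\<^sub>2 1 - w\<^sub>1 1 * (b\<^sub>2 - (\<Sum>j = 2..<n. k j * w\<^sub>2 j))) \<and>
        0 \<le> E * (w\<^sub>1 0 * (b\<^sub>2 - (\<Sum>j = 2..<n. k j * w\<^sub>2 j)) - (b\<^sub>1 - (\<Sum>j = 2..<n. k j * w\<^sub>1 j)) * w\<^sub>2 0)"
begin

lemma forward_loop:
  assumes "forward_inv s 0"
  shows "runs_to (WhilePos forward_guard forward_body) s
    ((forward_factor + (cost_factor forward_guard + weight forward_guard)) * (Suc n * bsize U ^ 3))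
    (\<lambda>s'. forward_inv s' n)"
proof -
  let ?M = "bsize U ^ 3" and ?g = "cost_factor forward_guard + weight forward_guard"
  have "runs_to (WhilePos forward_guard forward_body) s (n * (forward_factor * ?M + ?g * ?M) + ?g * ?M)
    (\<lambda>s'. (\<exists>i. forward_inv s' i) \<and> \<not> val forward_guard s' > 0)"
  proof (rule runs_to_WhilePos[where f = "\<lambda>s. n - nat (s rI)"])
    fix s assume "\<exists>i. forward_inv s i"
    then have "bounded U s" unfolding forward_inv_def by blast
    then show "cost forward_guard s + bsize (val forward_guard s) \<le> ?g * ?M" by (rule guard_cost_cubic)
  next
    fix s assume "\<exists>i. forward_inv s i" "val forward_guard s > 0"
    then obtain i where i: "forward_inv s i" "i < n" "s rI = int i"
      unfolding forward_inv_def loaded_def by force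
    have "n - nat (s' rI) < n - nat (s rI)" if "forward_inv s' (Suc i)" for s'
    proof -
      have "s' rI = int (Suc i)" using that unfolding forward_inv_def by blast
      then show ?thesis using i(2,3) by (simp only: nat_int)
    qed
    then show "runs_to forward_body s (forward_factor * ?M)
        (\<lambda>s'. (\<exists>i. forward_inv s' i) \<and> n - nat (s' rI) < n - nat (s rI))"
      using i by (intro runs_to_mono[OF forward_step[OF i(1,2)]]) auto
  qed (use assms in auto)
  then show ?thesis
  proof (rule runs_to_mono)
    show "n * (forward_factor * ?M + ?g * ?M) + ?g * ?M \<le> (forward_factor + ?g) * (Suc n * ?M)"
      by (simp add: algebra_simps)
    fix s' assume "(\<exists>i. forward_inv s' i) \<and> \<not> val forward_guard s' > 0"
    then obtain i where i: "forward_inv s' i" "\<not> val forward_guard s' > 0" by blast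
    then have "i = n" unfolding forward_inv_def loaded_def by auto
    then show "forward_inv s' n" using i by simp
  qed
qed

text \<open>The term \<open>Z * Z * Z\<close> per step bounds a coefficient below the index, hence
  below \<open>Z * Z\<close>, times an entry of a column. The cells from \<open>i\<close> on already
  hold the solution, while those below may still hold input.\<close>

definition backward_inv :: "memory \<Rightarrow> nat \<Rightarrow> bool" where
  "backward_inv s i \<longleftrightarrow> bounded U s \<and> loaded s \<and> s rI = int i \<and> 2 \<le> i \<and> i \<le> n \<and>
     (s rT\<^sub>1, s rT\<^sub>2) \<in> lat i \<and>
     \<bar>s rT\<^sub>1\<bar> \<le> Z + (int n - int i) * (Z * Z * Z) \<and> \<bar>s rT\<^sub>2\<bar> \<le> Z + (int n - int i) * (Z * Z * Z) \<and>
     (\<forall>j < n. record_ok s j) \<and> (\<Prod>j = 2..<n. index s j) dvd E \<and>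
     (\<forall>j \<in> {i..<n}. 0 \<le> s (int j) \<and> s (int j) < index s j) \<and>
     s rT\<^sub>1 = b\<^sub>1 - (\<Sum>j = i..<n. s (int j) * w\<^sub>1 j) \<and>
     s rT\<^sub>2 = b\<^sub>2 - (\<Sum>j = i..<n. s (int j) * w\<^sub>2 j)"

lemma backward_inv_init:
  assumes "forward_inv s n"
  shows "backward_inv s n"
proof -
  define p q r where "p = s rP" and "q = s rQ" and "r = s rR"
  have lat: "hnf_lattice p q r = lat n" and pos: "0 < p" "0 < r"
    and prod: "p * r * (\<Prod>j = 2..<n. index s j) dvd E"
    using assms two_le_n unfolding forward_inv_def p_def q_def r_def by auto
  \<comment> \<open>All columns lie in \<open>lat n\<close>, so \<open>p * r\<close> divides every
    minor of \<open>A\<close>. With \<open>p = r = 1\<close> the lattice is all of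
    \<open>\<int>\<^sup>2\<close> and contains \<open>b\<close>.\<close>
  have "p * r dvd 1"
    by (intro minors hnf_lattice_minor_dvd[of _ _ _ q]; unfold lat; intro columns_in_lat) simp_all
  then have "p dvd 1" "r dvd 1" by (blast dest: dvd_mult_left dvd_mult_right)+
  then have "p = 1" "r = 1" using pos by (auto simp: zdvd1_eq)
  then have "(b\<^sub>1, b\<^sub>2) \<in> lat n"
    unfolding lat[symmetric] by (intro hnf_latticeI[of _ b\<^sub>1 _ _ _ "b\<^sub>2 - b\<^sub>1 * q"]) auto
  moreover have "(\<Prod>j = 2..<n. index s j) dvd E" using prod by (rule dvd_mult_right)
  ultimately show ?thesis
    using assms two_le_n b_le_Z unfolding forward_inv_def backward_inv_def by simp
qed

lemma backward_step:
  assumes inv: "backward_inv s (Suc i)" and i: "2 \<le> i"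
  shows "runs_to (block backward_block) s (block_factor backward_block * bsize U ^ 3)
    (\<lambda>s'. backward_inv s' i)"
proof -
  define t\<^sub>1 t\<^sub>2 J k where "t\<^sub>1 = s rT\<^sub>1" and "t\<^sub>2 = s rT\<^sub>2" and "J = addr i"
    and "k = coefficient s i (s rT\<^sub>1) (s rT\<^sub>2)"
  have s: "bounded U s" "s rN = int n" "s rI = int i + 1" "(t\<^sub>1, t\<^sub>2) \<in> lat (Suc i)"
    and n: "i < n" and rec: "record_ok s i"
    and tle: "\<bar>t\<^sub>1\<bar> \<le> Z + (int n - int (Suc i)) * (Z * Z * Z)"
      "\<bar>t\<^sub>2\<bar> \<le> Z + (int n - int (Suc i)) * (Z * Z * Z)"
    and sums: "t\<^sub>1 = b\<^sub>1 - (\<Sum>j = Suc i..<n. s (int j) * w\<^sub>1 j)"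
      "t\<^sub>2 = b\<^sub>2 - (\<Sum>j = Suc i..<n. s (int j) * w\<^sub>2 j)"
    using inv unfolding backward_inv_def loaded_def t\<^sub>1_def t\<^sub>2_def by auto
  have J: "J = 8 * (int n + int i + 1)" "0 < J" "int n \<le> J"
    unfolding J_def addr_def by simp_all
  then have iJ: "int i < J" using n by linarith
  have idx: "0 < index s i" "index s i \<le> Z * Z" "s J = w\<^sub>1 i" "s (J + 1) = w\<^sub>2 i"
    using rec unfolding record_ok_def J_def by auto
  have k: "0 \<le> k" "k < index s i"
    using idx(1) unfolding k_def coefficient_def index_def by simp_all
  have k_def': "k = (t\<^sub>1 div s (J + 2) * s (J + 5) + (t\<^sub>2 - t\<^sub>1 div s (J + 2) * s (J + 3)) div s (J + 4)
      * s (J + 6)) mod s (J + 7)"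
    unfolding k_def coefficient_def t\<^sub>1_def t\<^sub>2_def J_def ..
  define s' where "s' = s(rI := int i, rJ := J, int i := k, rT\<^sub>1 := t\<^sub>1 - k * w\<^sub>1 i, rT\<^sub>2 := t\<^sub>2 - k * w\<^sub>2 i)"
  have "effect backward_block s = s'"
    unfolding backward_block_def s'_def k_def'
    using s J(1)[symmetric] J(2) iJ idx(3,4)
    by (simp add: minus_div_mult_eq_mod flip: t\<^sub>1_def t\<^sub>2_def)
  moreover have "backward_inv s' i"
  proof -
    have other: "s' a = s a" if "a \<notin> {rI, rJ, rT\<^sub>1, rT\<^sub>2, int i}" for a
      using that by (simp add: s'_def)
    have ZZ: "\<bar>k * w\<^sub>1 i\<bar> \<le> Z * Z * Z" "\<bar>k * w\<^sub>2 i\<bar> \<le> Z * Z * Z"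
      using k idx(2) w_le_Z[OF n] by (intro abs_mult_mono; simp)+
    have step: "Z + (int n - int (Suc i)) * (Z * Z * Z) + Z * Z * Z = Z + (int n - int i) * (Z * Z * Z)"
      by (simp add: algebra_simps)
    have t'_le: "\<bar>t\<^sub>1 - k * w\<^sub>1 i\<bar> \<le> Z + (int n - int i) * (Z * Z * Z)"
      "\<bar>t\<^sub>2 - k * w\<^sub>2 i\<bar> \<le> Z + (int n - int i) * (Z * Z * Z)"
      using tle ZZ step by linarith+
    have "(int n - int i) * (Z * Z * Z) \<le> Z * (Z * Z * Z)"
      using n_le_Z Z_powers by (intro mult_right_mono) auto
    also have "\<dots> = Z * Z * Z * Z" by simp
    finally have "Z + (int n - int i) * (Z * Z * Z) \<le> U"
      unfolding U_eq using Z_powers by linarith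
    then have tU: "\<bar>t\<^sub>1 - k * w\<^sub>1 i\<bar> \<le> U" "\<bar>t\<^sub>2 - k * w\<^sub>2 i\<bar> \<le> U" using t'_le by linarith+
    have "8 * (int n + int i + 1) \<le> 24 * Z" using n n_le_Z by simp
    moreover have "Z \<le> Z * Z * Z * Z" using Z_powers by linarith
    ultimately have "J \<le> U" unfolding J U_eq by linarith
    moreover have "k \<le> U" using k idx(2) Z_powers unfolding U_eq by linarith
    ultimately have "bounded U s'"
      unfolding s'_def using s(1) tU k J iJ by (intro bounded_upd) auto
    moreover have "loaded s'" using inv unfolding backward_inv_def loaded_def by (simp add: other)
    moreover have "(s' rT\<^sub>1, s' rT\<^sub>2) \<in> lat i"
      using rec s(4) unfolding record_ok_def by (simp add: s'_def k_def t\<^sub>1_def t\<^sub>2_def)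
    moreover have recs: "record_ok s' j = record_ok s j" "index s' j = index s j" for j
      by (rule record_ok_cong; rule other; use n in \<open>auto simp: addr_def\<close>)+
    moreover have "s' (int i) = k" by (simp add: s'_def)
    moreover have later: "s' (int j) = s (int j)" if "Suc i \<le> j" for j
      using that by (intro other) auto
    moreover have "(\<Sum>j = Suc i..<n. s' (int j) * w j) = (\<Sum>j = Suc i..<n. s (int j) * w j)" for w
      by (intro sum.cong) (use later in auto)
    moreover have "s' rT\<^sub>1 = t\<^sub>1 - k * w\<^sub>1 i" "s' rT\<^sub>2 = t\<^sub>2 - k * w\<^sub>2 i" "s' rI = int i"
      by (simp_all add: s'_def)
    moreover have "0 \<le> s' (int j) \<and> s' (int j) < index s j" if "j \<in> {i..<n}" for j
    proof (cases "j = i")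
      case False
      then have "j \<in> {Suc i..<n}" using that by simp
      then show ?thesis using inv later unfolding backward_inv_def by auto
    qed (use k in \<open>simp add: s'_def\<close>)
    ultimately show ?thesis
      using inv i n t'_le sums unfolding backward_inv_def
      by (simp add: sum.atLeast_Suc_lessThan)
  qed
  ultimately show ?thesis
    using runs_to_block_cubic[OF s(1)] by (auto intro: runs_to_mono)
qed

lemma backward_loop:
  assumes "backward_inv s n"
  shows "runs_to (WhilePos backward_guard (block backward_block)) s
    ((block_factor backward_block + (cost_factor backward_guard + weight backward_guard))
      * (Suc n * bsize U ^ 3))
    (\<lambda>s'. backward_inv s' 2)"
proof -
  let ?M = "bsize U ^ 3" and ?g = "cost_factor backward_guard + weight backward_guard"
  let ?b = "block_factor backward_block"
  have "runs_to (WhilePos backward_guard (block backward_block)) s (n * (?b * ?M + ?g * ?M) + ?g * ?M)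
    (\<lambda>s'. (\<exists>i. backward_inv s' i) \<and> \<not> val backward_guard s' > 0)"
  proof (rule runs_to_WhilePos[where f = "\<lambda>s. nat (s rI)"])
    fix s assume "\<exists>i. backward_inv s i"
    then have "bounded U s" unfolding backward_inv_def by blast
    then show "cost backward_guard s + bsize (val backward_guard s) \<le> ?g * ?M"
      by (rule guard_cost_cubic)
  next
    fix s assume "\<exists>i. backward_inv s i" "val backward_guard s > 0"
    then obtain j where j: "backward_inv s j" "2 < j" "s rI = int j"
      unfolding backward_inv_def by force
    then obtain i where i: "j = Suc i" "2 \<le> i" by (cases j) auto
    have "nat (s' rI) < nat (s rI)" if "backward_inv s' i" for s'
    proof -
      have "s' rI = int i" using that unfolding backward_inv_def by blast
      then show ?thesis using i(1) j(3) by (simp only: nat_int)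
    qed
    then show "runs_to (block backward_block) s (?b * ?M)
        (\<lambda>s'. (\<exists>i. backward_inv s' i) \<and> nat (s' rI) < nat (s rI))"
      using i j by (intro runs_to_mono[OF backward_step[OF j(1)[unfolded i(1)] i(2)]]) auto
  next
    show "nat (s rI) \<le> n" using assms unfolding backward_inv_def by simp
  qed (use assms in auto)
  then show ?thesis
  proof (rule runs_to_mono)
    show "n * (?b * ?M + ?g * ?M) + ?g * ?M \<le> (?b + ?g) * (Suc n * ?M)"
      by (simp add: algebra_simps)
    fix s' assume "(\<exists>i. backward_inv s' i) \<and> \<not> val backward_guard s' > 0"
    then obtain i where i: "backward_inv s' i" "\<not> val backward_guard s' > 0" by blast
    then have "i = 2" unfolding backward_inv_def by auto
    then show "backward_inv s' 2" using i by simp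
  qed
qed

definition solution :: "memory \<Rightarrow> bool" where
  "solution s \<longleftrightarrow> (\<forall>j < n. 0 \<le> s (int j)) \<and>
     (\<Sum>j < n. s (int j) * w\<^sub>1 j) = b\<^sub>1 \<and> (\<Sum>j < n. s (int j) * w\<^sub>2 j) = b\<^sub>2"

lemma final_solution:
  assumes inv: "backward_inv s 2"
  shows "solution (effect final_block s)"
proof -
  define t\<^sub>1 t\<^sub>2 x\<^sub>0 x\<^sub>1 where "t\<^sub>1 = s rT\<^sub>1" and "t\<^sub>2 = s rT\<^sub>2"
    and "x\<^sub>0 = (t\<^sub>1 * w\<^sub>2 1 - w\<^sub>1 1 * t\<^sub>2) div E" and "x\<^sub>1 = (w\<^sub>1 0 * t\<^sub>2 - t\<^sub>1 * w\<^sub>2 0) div E"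
  have eff: "effect final_block s = s(0 := x\<^sub>0, 1 := x\<^sub>1)"
    using inv unfolding backward_inv_def loaded_def final_block_def x\<^sub>0_def x\<^sub>1_def t\<^sub>1_def t\<^sub>2_def by simp
  \<comment> \<open>The assumption \<open>nonneg\<close> wants \<open>k j \<ge> 0\<close> for every
    \<open>j\<close>, whereas cells outside this range may hold leftover input.\<close>
  define k where "k j = (if j \<in> {2..<n} then s (int j) else 0)" for j
  have t: "t\<^sub>1 = b\<^sub>1 - (\<Sum>j = 2..<n. k j * w\<^sub>1 j)" "t\<^sub>2 = b\<^sub>2 - (\<Sum>j = 2..<n. k j * w\<^sub>2 j)"
    and lat: "(t\<^sub>1, t\<^sub>2) \<in> lat 2" and dvd: "(\<Prod>j = 2..<n. index s j) dvd E"
    and range: "\<And>j. j \<in> {2..<n} \<Longrightarrow> 0 \<le> k j \<and> k j < index s j"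
    using inv unfolding backward_inv_def t\<^sub>1_def t\<^sub>2_def k_def by auto
  have "1 \<le> index s j" if "j \<in> {2..<n}" for j using range[OF that] by linarith
  from sum_minus_1_le_prod_minus_1[of "{2..<n}" "index s", OF _ this]
  have prod: "1 \<le> (\<Prod>j = 2..<n. index s j)"
    "(\<Sum>j = 2..<n. index s j - 1) \<le> (\<Prod>j = 2..<n. index s j) - 1" by auto
  have "(\<Prod>j = 2..<n. index s j) \<le> \<bar>E\<bar>" using dvd E_le_Z prod(1) by (intro zdvd_imp_le) auto
  moreover have "(\<Sum>j = 2..<n. k j) \<le> (\<Sum>j = 2..<n. index s j - 1)"
    using range by (intro sum_mono) force
  ultimately have "(\<Sum>j = 2..<n. k j) \<le> \<bar>E\<bar> - 1" using prod(2) by linarith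
  moreover have "0 \<le> k j" for j using range[of j] unfolding k_def by auto
  \<comment> \<open>The extra factor \<open>E\<close> makes the sign of the determinant irrelevant,
    since \<open>E * E\<close> is positive.\<close>
  ultimately have "0 \<le> E * (E * x\<^sub>0)" "0 \<le> E * (E * x\<^sub>1)"
    using nonneg[of k] cramer[OF lat] unfolding t[symmetric] x\<^sub>0_def x\<^sub>1_def by simp_all
  then have "0 \<le> (E * E) * x\<^sub>0" "0 \<le> (E * E) * x\<^sub>1" by (simp_all add: mult.assoc)
  then have x: "0 \<le> x\<^sub>0" "0 \<le> x\<^sub>1" using E_le_Z(4) by (simp_all add: zero_le_mult_iff)
  let ?s = "s(0 := x\<^sub>0, 1 := x\<^sub>1)"
  have "0 \<le> ?s (int j)" if "j < n" for j
    using x range[of j] that unfolding k_def by (cases "j = 0"; cases "j = 1") auto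
  moreover have "(\<Sum>j < n. ?s (int j) * w j) = x\<^sub>0 * w 0 + x\<^sub>1 * w 1 + (\<Sum>j = 2..<n. k j * w j)"
    for w :: "nat \<Rightarrow> int"
  proof -
    have "{..<n} = insert 0 (insert 1 {2..<n})" using two_le_n by auto
    moreover have "(\<Sum>j = 2..<n. ?s (int j) * w j) = (\<Sum>j = 2..<n. k j * w j)"
      unfolding k_def by (intro sum.cong) auto
    ultimately show ?thesis by simp
  qed
  moreover have "x\<^sub>0 * w\<^sub>1 0 + x\<^sub>1 * w\<^sub>1 1 = t\<^sub>1" "x\<^sub>0 * w\<^sub>2 0 + x\<^sub>1 * w\<^sub>2 1 = t\<^sub>2"
    unfolding x\<^sub>0_def x\<^sub>1_def by (rule cramer[OF lat])+
  ultimately show ?thesis unfolding solution_def eff using t by simp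
qed

lemma solver_correct:
  assumes "input s"
  shows "runs_to solver s (solver_factor * (Suc n * bsize U ^ 3)) solution"
proof -
  let ?M = "Suc n * bsize U ^ 3"
  have small: "c * bsize U ^ 3 \<le> c * ?M" for c by simp
  have ZU: "Z \<le> U" unfolding U_eq using Z_powers by linarith
  then have "bounded U s" using assms unfolding input_def bounded_def by (meson order_trans)
  from runs_to_block_cubic[OF this refl]
  have 1: "runs_to (block init_block) s (block_factor init_block * ?M) (\<lambda>s'. forward_inv s' 0)"
    by (rule runs_to_mono) (use small forward_inv_init[OF assms] in auto)
  have 4: "runs_to (block final_block) s (block_factor final_block * ?M) solution"
    if "backward_inv s 2" for s
  proof -
    have "bounded U s" using that unfolding backward_inv_def by blast
    from runs_to_block_cubic[OF this refl] show ?thesis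
      by (rule runs_to_mono) (use small final_solution[OF that] in auto)
  qed
  have "runs_to solver s (block_factor init_block * ?M
      + ((forward_factor + (cost_factor forward_guard + weight forward_guard)) * ?M
      + ((block_factor backward_block + (cost_factor backward_guard + weight backward_guard)) * ?M
      + block_factor final_block * ?M))) solution"
    unfolding solver_def
    by (intro runs_to_Seq[OF 1] runs_to_Seq[OF forward_loop] runs_to_Seq[OF backward_loop] 4
        backward_inv_init)
  then show ?thesis by (rule runs_to_mono) (simp_all add: solver_factor_def algebra_simps)
qed

end

section \<open>Encoding of the input\<close>

lemma det_2x2:
  fixes M :: "'a :: comm_ring_1 mat"
  assumes "M \<in> carrier_mat 2 2"
  shows "det M = M $$ (0, 0) * M $$ (1, 1) - M $$ (0, 1) * M $$ (1, 0 :: nat)"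
proof -
  have 1: "det (mat (Suc 0) (Suc 0) f) = f (0, 0)" for f :: "nat \<times> nat \<Rightarrow> 'a"
    by (subst det_single) simp_all
  show ?thesis
    using assms by (subst laplace_expansion_row[of _ 2 0])
      (auto simp: numeral_2_eq_2 cofactor_def 1 mat_delete_def algebra_simps)
qed

lemma nth_concat_pairs:
  assumes "\<And>xs. xs \<in> set xss \<Longrightarrow> length xs = 2" "i < length xss" "k < 2"
  shows "concat xss ! (2 * i + k) = xss ! i ! k"
  using assms(1,2)
proof (induction xss arbitrary: i)
  case (Cons xs xss)
  show ?case
  proof (cases i)
    case 0
    then show ?thesis using Cons.prems(1)[of xs] assms(3) by (simp add: nth_append)
  next
    case (Suc i')
    have "concat (xs # xss) ! (2 * i + k) = concat xss ! (2 * i' + k)"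
      using Cons.prems(1)[of xs] Suc by (simp add: nth_append)
    then show ?thesis using Cons.IH[of i'] Cons.prems Suc by simp
  qed
qed simp

lemma binary_size_ge:
  shows "length xs \<le> binary_size xs" and "x \<in> set xs \<Longrightarrow> bsize x \<le> binary_size xs"
proof -
  show "length xs \<le> binary_size xs"
    unfolding binary_size_def
  proof (induction xs)
    case (Cons x xs)
    then show ?case using bsize_ge_1[of x] by simp
  qed simp
  show "x \<in> set xs \<Longrightarrow> bsize x \<le> binary_size xs"
    unfolding binary_size_def by (intro member_le_sum_list) auto
qed

lemma abs_load_le: "\<bar>load xs a\<bar> \<le> 2 ^ binary_size xs"
proof (cases "0 \<le> a \<and> a < int (length xs)")
  case True
  then have "load xs a \<in> set xs" unfolding load_def by (auto intro!: nth_mem)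
  then have "bsize (load xs a) \<le> Suc (binary_size xs)"
    using binary_size_ge(2) le_SucI by blast
  then show ?thesis unfolding bsize_le_iff by simp
qed (auto simp: load_def)

lemma load_encode:
  assumes A: "A \<in> carrier_mat 2 n" and b: "b \<in> carrier_vec 2"
  shows "load (encode A b) 0 = int n" "load (encode A b) 1 = b $ 0" "load (encode A b) 2 = b $ 1"
    "j < n \<Longrightarrow> load (encode A b) (3 + 2 * int j) = A $$ (0, j)"
    "j < n \<Longrightarrow> load (encode A b) (4 + 2 * int j) = A $$ (1, j)"
    "length (encode A b) = 3 + 2 * n"
proof -
  let ?c = "concat (map list_of_vec (cols A))"
  have b2: "list_of_vec b = [b $ 0, b $ 1]"
    using b by (simp add: list_of_vec_map numeral_2_eq_2)
  have enc: "encode A b = int n # b $ 0 # b $ 1 # ?c"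
    unfolding encode_def b2 using A by simp
  have len: "length (list_of_vec v) = 2" if "v \<in> set (cols A)" for v
    using that A by (auto simp: cols_def)
  then have "map length (map list_of_vec (cols A)) = map (\<lambda>_. 2) (cols A)" by simp
  then have lenc: "length ?c = 2 * n"
    unfolding length_concat using A by (simp add: sum_list_triv del: map_map)
  then show "length (encode A b) = 3 + 2 * n" unfolding enc by simp
  show "load (encode A b) 0 = int n" "load (encode A b) 1 = b $ 0" "load (encode A b) 2 = b $ 1"
    unfolding enc load_def by (simp_all add: nth_Cons')
  have c: "?c ! (2 * j + k) = A $$ (k, j)" if "j < n" "k < 2" for j k
    using that A len by (subst nth_concat_pairs) (auto simp: list_of_vec_index)
  have "nat (3 + 2 * int j) = Suc (Suc (Suc (2 * j + 0)))" "nat (4 + 2 * int j) = Suc (Suc (Suc (2 * j + 1)))"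
    by simp_all
  then show "j < n \<Longrightarrow> load (encode A b) (3 + 2 * int j) = A $$ (0, j)"
    "j < n \<Longrightarrow> load (encode A b) (4 + 2 * int j) = A $$ (1, j)"
    unfolding load_def enc using c[of j 0] c[of j 1] lenc by simp_all
qed

section \<open>Nonnegativity of the solution\<close>

text \<open>Lagrange's identity: the product of the squared lengths is the squared determinant plus
  the squared inner product.\<close>

lemma cauchy_schwarz_det:
  fixes u\<^sub>1 u\<^sub>2 v\<^sub>1 v\<^sub>2 :: real
  shows "\<bar>u\<^sub>1 * v\<^sub>2 - v\<^sub>1 * u\<^sub>2\<bar> \<le> sqrt (u\<^sub>1\<^sup>2 + u\<^sub>2\<^sup>2) * sqrt (v\<^sub>1\<^sup>2 + v\<^sub>2\<^sup>2)"
proof -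
  have "(u\<^sub>1\<^sup>2 + u\<^sub>2\<^sup>2) * (v\<^sub>1\<^sup>2 + v\<^sub>2\<^sup>2) = (u\<^sub>1 * v\<^sub>2 - v\<^sub>1 * u\<^sub>2)\<^sup>2 + (u\<^sub>1 * v\<^sub>1 + u\<^sub>2 * v\<^sub>2)\<^sup>2"
    by (simp add: power2_eq_square algebra_simps)
  then have "(u\<^sub>1 * v\<^sub>2 - v\<^sub>1 * u\<^sub>2)\<^sup>2 \<le> (u\<^sub>1\<^sup>2 + u\<^sub>2\<^sup>2) * (v\<^sub>1\<^sup>2 + v\<^sub>2\<^sup>2)" by simp
  then show ?thesis
    unfolding real_sqrt_mult[symmetric] by (simp add: real_le_rsqrt)
qed

text \<open>Here \<open>f j\<close> and \<open>c * (\<Sum>j<n. f j) + (\<Sum>j<n. y j * f j)\<close> are the values of a linear functional,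
  one of the two coordinates with respect to \<open>B\<close> scaled by \<open>(det B)\<^sup>2\<close>, at the columns of \<open>A\<close> and
  at \<open>b\<close>. The single column \<open>i\<close> of \<open>B\<close> in \<open>c v\<close> pays for all the columns of \<open>N\<close>.\<close>

lemma functional_nonneg:
  fixes f y :: "nat \<Rightarrow> real" and k :: "nat \<Rightarrow> int" and d L :: real
  assumes d: "1 \<le> d" and L: "0 \<le> L" and n: "2 \<le> n"
    and f: "\<And>j. j < n \<Longrightarrow> 0 \<le> f j" "\<And>j. 2 \<le> j \<Longrightarrow> j < n \<Longrightarrow> f j \<le> d * L"
    and i: "i < 2" "f i = d\<^sup>2"
    and y: "\<And>j. j < n \<Longrightarrow> 0 \<le> y j"
    and k: "\<And>j. 0 \<le> k j" "real_of_int (\<Sum>j = 2..<n. k j) \<le> d - 1"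
  defines "c \<equiv> L / d * (d - 1)"
  shows "0 \<le> c * (\<Sum>j<n. f j) + (\<Sum>j<n. y j * f j) - (\<Sum>j = 2..<n. real_of_int (k j) * f j)"
proof -
  have c: "0 \<le> c" unfolding c_def using d L by simp
  have "(\<Sum>j = 2..<n. real_of_int (k j) * f j) \<le> (\<Sum>j = 2..<n. real_of_int (k j) * (d * L))"
    using f k by (intro sum_mono mult_left_mono) auto
  also have "\<dots> = real_of_int (\<Sum>j = 2..<n. k j) * (d * L)" by (simp add: sum_distrib_right)
  also have "\<dots> \<le> (d - 1) * (d * L)" using k(2) d L by (intro mult_right_mono) auto
  \<comment> \<open>Here the constant of the theorem is used exactly: \<open>L / d * (d - 1)\<close>
    times \<open>f i = d\<^sup>2\<close> equals the worst total loss
    \<open>(d - 1) * (d * L)\<close>.\<close>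
  also have "\<dots> = c * f i" unfolding c_def i using d by (simp add: power2_eq_square)
  also have "\<dots> \<le> c * (\<Sum>j<n. f j)"
    using i n f c by (intro mult_left_mono member_le_sum) auto
  finally have "(\<Sum>j = 2..<n. real_of_int (k j) * f j) \<le> c * (\<Sum>j<n. f j)" .
  moreover have "0 \<le> (\<Sum>j<n. y j * f j)" using f y by (intro sum_nonneg) auto
  ultimately show ?thesis by linarith
qed

lemma mult_mat_vec_index_sum:
  assumes "M \<in> carrier_mat m n" "x \<in> carrier_vec n" "i < m"
  shows "(M *\<^sub>v x) $ i = (\<Sum>j<n. M $$ (i, j) * x $ j)"
  using assms by (simp add: scalar_prod_def lessThan_atLeast0)

lemma column_length_le_longest:
  assumes M: "M \<in> carrier_mat 2 m" and j: "j < m"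
  shows "sqrt ((real_of_int (M $$ (0, j)))\<^sup>2 + (real_of_int (M $$ (1, j)))\<^sup>2) \<le> longest_column M"
proof -
  have "euclidean_length (real_vec (col M j))
      = sqrt ((real_of_int (M $$ (0, j)))\<^sup>2 + (real_of_int (M $$ (1, j)))\<^sup>2)"
    using M j unfolding euclidean_length_def
    by (simp add: scalar_prod_def numeral_2_eq_2 power2_eq_square)
  moreover have "col M j \<in> set (cols M)" using M j by (auto simp: cols_def)
  ultimately show ?thesis unfolding longest_column_def by (metis Max_ge List.finite_set finite_imageI imageI)
qed

lemma col_coneE:
  assumes "u \<in> col_cone M" "M \<in> carrier_mat m n"
  obtains x where "u = real_mat M *\<^sub>v x" "x \<in> carrier_vec n" "\<And>j. j < n \<Longrightarrow> 0 \<le> x $ j"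
proof -
  have dim: "dim_col M = n" using assms(2) by simp
  obtain x where "u = real_mat M *\<^sub>v x" "x \<in> carrier_vec n" "0\<^sub>v n \<le> x"
    using assms(1) unfolding col_cone_def dim by blast
  then show ?thesis using that[of x] by (simp add: less_eq_vec_def)
qed

lemma column_in_col_cone:
  assumes M: "M \<in> carrier_mat m n" and j: "j < n"
  shows "real_vec (col M j) \<in> col_cone M"
proof -
  have "real_vec (col M j) = real_mat M *\<^sub>v unit_vec n j"
    using M j by (intro eq_vecI) (auto simp: scalar_prod_right_unit)
  moreover have "0\<^sub>v n \<le> (unit_vec n j :: real vec)" by (auto simp: less_eq_vec_def unit_vec_def)
  ultimately show ?thesis using M unfolding col_cone_def by auto
qed

locale cone_instance =
  fixes n :: nat and A B N :: "int mat" and b :: "int vec"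
  assumes n: "2 < n"
    and B: "B \<in> carrier_mat 2 2" and N: "N \<in> carrier_mat 2 (n - 2)"
    and A_eq: "A = block_row B N" and det_B: "det B \<noteq> 0"
    and cone: "col_cone B = col_cone A"
    and b: "b \<in> carrier_vec 2"
    and b_deep: "real_vec b \<in>
        (longest_column B * longest_column N / real_of_int \<bar>det B\<bar> * (real_of_int \<bar>det B\<bar> - 1))
          \<cdot>\<^sub>v real_vec (col_sum A) +o col_cone A"
begin

lemma A: "A \<in> carrier_mat 2 n"
  using n B N unfolding A_eq block_row_def by (intro carrier_matI) simp_all

lemma A_entries:
  "i < 2 \<Longrightarrow> j < 2 \<Longrightarrow> B $$ (i, j) = A $$ (i, j)"
  "i < 2 \<Longrightarrow> 2 \<le> j \<Longrightarrow> j < n \<Longrightarrow> N $$ (i, j - 2) = A $$ (i, j)"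
  unfolding A_eq block_row_def using B N n by (subst mat_of_cols_index; auto simp: nth_append)+

lemma det_B_eq: "det B = A $$ (0, 0) * A $$ (1, 1) - A $$ (0, 1) * A $$ (1, 0)"
  using det_2x2[OF B] by (simp add: A_entries)

text \<open>The equality of the two cones enters here: every column of \<open>A\<close> is a
  nonnegative combination of the columns of \<open>B\<close>, so a functional that is nonnegative on
  these is nonnegative on all columns. \<open>p\<close> and \<open>q\<close> will be the rows of
  \<open>det B\<close> times the adjugate of \<open>B\<close>.\<close>

lemma functional_at_b_nonneg:
  fixes p q :: real and f :: "nat \<Rightarrow> real" and k :: "nat \<Rightarrow> int"
  defines "f \<equiv> \<lambda>j. p * A $$ (0, j) + q * A $$ (1, j)"
  assumes f01: "0 \<le> f 0" "0 \<le> f 1" and i: "i < 2" "f i = (det B)\<^sup>2"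
    and bound: "\<And>u v. p * u + q * v \<le> \<bar>det B\<bar> * (longest_column B * sqrt (u\<^sup>2 + v\<^sup>2))"
    and k: "\<And>j. 0 \<le> k j" "(\<Sum>j = 2..<n. k j) \<le> \<bar>det B\<bar> - 1"
  shows "0 \<le> p * (b $ 0 - (\<Sum>j = 2..<n. k j * A $$ (0, j))) + q * (b $ 1 - (\<Sum>j = 2..<n. k j * A $$ (1, j)))"
proof -
  let ?d = "real_of_int \<bar>det B\<bar>"
  have d: "1 \<le> ?d" using det_B by linarith
  have nonneg: "0 \<le> longest_column M" if "M \<in> carrier_mat 2 m" "0 < m" for M m
    using column_length_le_longest[OF that] by (rule order_trans[rotated]) simp
  have LB: "0 \<le> longest_column B" using B by (rule nonneg) simp
  have LN: "0 \<le> longest_column N" using N by (rule nonneg) (use n in simp)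
  have f_nonneg: "0 \<le> f j" if "j < n" for j
  proof -
    have "real_vec (col A j) \<in> col_cone B"
      unfolding cone using A that by (rule column_in_col_cone)
    then obtain z where z: "real_vec (col A j) = real_mat B *\<^sub>v z" "z \<in> carrier_vec 2"
      "\<And>j. j < 2 \<Longrightarrow> 0 \<le> z $ j"
      using col_coneE[OF _ B] by blast
    have "real_of_int (A $$ (i, j)) = A $$ (i, 0) * z $ 0 + A $$ (i, 1) * z $ 1" if "i < 2" for i
    proof -
      have "real_of_int (A $$ (i, j)) = real_vec (col A j) $ i" using A \<open>j < n\<close> that by simp
      also have "\<dots> = (\<Sum>j<2. real_mat B $$ (i, j) * z $ j)"
        unfolding z(1) using B z(2) that by (intro mult_mat_vec_index_sum) auto
      finally show ?thesis using B that by (simp add: numeral_2_eq_2 A_entries)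
    qed
    from this[of 0] this[of 1] have "f j = f 0 * z $ 0 + f 1 * z $ 1"
      unfolding f_def by (simp add: algebra_simps)
    then show ?thesis using f01 z(3) by simp
  qed
  have f_le: "f j \<le> ?d * (longest_column B * longest_column N)" if "2 \<le> j" "j < n" for j
  proof -
    have "sqrt ((real_of_int (A $$ (0, j)))\<^sup>2 + (real_of_int (A $$ (1, j)))\<^sup>2) \<le> longest_column N"
      using column_length_le_longest[OF N, of "j - 2"] that by (simp add: A_entries)
    then have "?d * (longest_column B
          * sqrt ((real_of_int (A $$ (0, j)))\<^sup>2 + (real_of_int (A $$ (1, j)))\<^sup>2))
        \<le> ?d * (longest_column B * longest_column N)"
      using d LB by (intro mult_left_mono) auto
    then show ?thesis unfolding f_def using bound by (rule order_trans[rotated])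
  qed
  define c where "c = longest_column B * longest_column N / ?d * (?d - 1)"
  obtain u where u: "real_vec b = c \<cdot>\<^sub>v real_vec (col_sum A) + u" "u \<in> col_cone A"
    using b_deep unfolding c_def elt_set_plus_def by blast
  obtain y where y: "u = real_mat A *\<^sub>v y" "y \<in> carrier_vec n" "\<And>j. j < n \<Longrightarrow> 0 \<le> y $ j"
    using col_coneE[OF u(2) A] by blast
  have b_eq: "real_of_int (b $ i) = c * (\<Sum>j<n. A $$ (i, j)) + (\<Sum>j<n. A $$ (i, j) * y $ j)"
    if "i < 2" for i
  proof -
    have "real_of_int (b $ i) = real_vec b $ i" using b that by simp
    also have "\<dots> = c * (\<Sum>j<n. A $$ (i, j)) + u $ i"
      unfolding u(1) using A that y(1) by (simp add: col_sum_def)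
    also have "u $ i = (\<Sum>j<n. real_mat A $$ (i, j) * y $ j)"
      unfolding y(1) using A y(2) that by (intro mult_mat_vec_index_sum) auto
    finally show ?thesis using A that by simp
  qed
  have k_sum: "real_of_int (\<Sum>j = 2..<n. k j) \<le> ?d - 1" using k(2) by linarith
  have two: "(0 :: nat) < 2" "(1 :: nat) < 2" by simp_all
  have "p * (b $ 0 - (\<Sum>j = 2..<n. k j * A $$ (0, j))) + q * (b $ 1 - (\<Sum>j = 2..<n. k j * A $$ (1, j)))
      = c * (\<Sum>j<n. f j) + (\<Sum>j<n. y $ j * f j) - (\<Sum>j = 2..<n. real_of_int (k j) * f j)"
    unfolding of_int_diff b_eq[OF two(1)] b_eq[OF two(2)] f_def
    by (simp add: algebra_simps sum.distrib sum_distrib_left)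
  also have "0 \<le> \<dots>"
    unfolding c_def
    by (rule functional_nonneg[OF d _ _ f_nonneg f_le _ _ _ k(1) k_sum])
      (use LB LN n i y in \<open>auto simp: power2_abs\<close>)
  finally show ?thesis .
qed

text \<open>Cramer's numerators, multiplied by \<open>det B\<close>, are functionals with value
  \<open>(det B)\<^sup>2\<close> at one column of \<open>B\<close> and 0 at the other. Each is, up
  to sign, \<open>det B\<close> times a determinant against that other column, whose length is at
  most \<open>longest_column B\<close>.\<close>

lemma cramer_nonneg:
  fixes k :: "nat \<Rightarrow> int"
  assumes k: "\<And>j. 0 \<le> k j" "(\<Sum>j = 2..<n. k j) \<le> \<bar>det B\<bar> - 1"
  defines "t\<^sub>1 \<equiv> b $ 0 - (\<Sum>j = 2..<n. k j * A $$ (0, j))"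
    and "t\<^sub>2 \<equiv> b $ 1 - (\<Sum>j = 2..<n. k j * A $$ (1, j))"
  shows "0 \<le> det B * (t\<^sub>1 * A $$ (1, 1) - A $$ (0, 1) * t\<^sub>2)"
    and "0 \<le> det B * (A $$ (0, 0) * t\<^sub>2 - t\<^sub>1 * A $$ (1, 0))"
proof -
  let ?E = "real_of_int (det B)"
  have E: "?E = real_of_int (A $$ (0, 0)) * A $$ (1, 1) - real_of_int (A $$ (0, 1)) * A $$ (1, 0)"
    unfolding det_B_eq by simp
  have square: "(real_of_int (det B))\<^sup>2
      = ?E * (real_of_int (A $$ (0, 0)) * A $$ (1, 1) - real_of_int (A $$ (0, 1)) * A $$ (1, 0))"
    unfolding E[symmetric] power2_eq_square ..
  have len: "sqrt ((real_of_int (A $$ (0, j)))\<^sup>2 + (real_of_int (A $$ (1, j)))\<^sup>2) \<le> longest_column B"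
    if "j < 2" for j
    using column_length_le_longest[OF B that] that by (simp add: A_entries)
  have bound: "?E * (u * A $$ (1, j) - A $$ (0, j) * v) \<le> \<bar>?E\<bar> * (longest_column B * sqrt (u\<^sup>2 + v\<^sup>2))"
    "?E * (A $$ (0, j) * v - u * A $$ (1, j)) \<le> \<bar>?E\<bar> * (longest_column B * sqrt (u\<^sup>2 + v\<^sup>2))"
    if "j < 2" for j and u v :: real
  proof -
    let ?D = "u * A $$ (1, j) - A $$ (0, j) * v"
    have "\<bar>?D\<bar> \<le> sqrt (u\<^sup>2 + v\<^sup>2)
        * sqrt ((real_of_int (A $$ (0, j)))\<^sup>2 + (real_of_int (A $$ (1, j)))\<^sup>2)"
      by (rule cauchy_schwarz_det)
    also have "\<dots> \<le> sqrt (u\<^sup>2 + v\<^sup>2) * longest_column B"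
      using len[OF that] by (intro mult_left_mono) auto
    finally have "\<bar>?E * ?D\<bar> \<le> \<bar>?E\<bar> * (longest_column B * sqrt (u\<^sup>2 + v\<^sup>2))"
      unfolding abs_mult by (intro mult_left_mono) (auto simp: mult.commute)
    moreover have "?E * (A $$ (0, j) * v - u * A $$ (1, j)) = - (?E * ?D)" by (simp add: algebra_simps)
    ultimately show "?E * ?D \<le> \<bar>?E\<bar> * (longest_column B * sqrt (u\<^sup>2 + v\<^sup>2))"
      "?E * (A $$ (0, j) * v - u * A $$ (1, j)) \<le> \<bar>?E\<bar> * (longest_column B * sqrt (u\<^sup>2 + v\<^sup>2))"
      by linarith+
  qed
  have "0 \<le> (?E * A $$ (1, 1)) * t\<^sub>1 + (- ?E * A $$ (0, 1)) * t\<^sub>2"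
    unfolding t\<^sub>1_def t\<^sub>2_def
  proof (rule functional_at_b_nonneg[of _ _ 0])
    show "(?E * A $$ (1, 1)) * u + (- ?E * A $$ (0, 1)) * v \<le> \<bar>det B\<bar> * (longest_column B * sqrt (u\<^sup>2 + v\<^sup>2))"
      for u v using bound(1)[of 1 u v] by (simp add: algebra_simps)
    show "(?E * A $$ (1, 1)) * A $$ (0, 0) + (- ?E * A $$ (0, 1)) * A $$ (1, 0) = (det B)\<^sup>2"
      unfolding of_int_power square by (simp add: algebra_simps)
    then show "0 \<le> (?E * A $$ (1, 1)) * A $$ (0, 0) + (- ?E * A $$ (0, 1)) * A $$ (1, 0)" by simp
  qed (use k in auto)
  then have "0 \<le> real_of_int (det B * (t\<^sub>1 * A $$ (1, 1) - A $$ (0, 1) * t\<^sub>2))"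
    by (simp add: algebra_simps)
  then show "0 \<le> det B * (t\<^sub>1 * A $$ (1, 1) - A $$ (0, 1) * t\<^sub>2)" by (simp only: of_int_0_le_iff)
  have "0 \<le> (- ?E * A $$ (1, 0)) * t\<^sub>1 + (?E * A $$ (0, 0)) * t\<^sub>2"
    unfolding t\<^sub>1_def t\<^sub>2_def
  proof (rule functional_at_b_nonneg[of _ _ 1])
    show "(- ?E * A $$ (1, 0)) * u + (?E * A $$ (0, 0)) * v \<le> \<bar>det B\<bar> * (longest_column B * sqrt (u\<^sup>2 + v\<^sup>2))"
      for u v using bound(2)[of 0 v u] by (simp add: algebra_simps)
    show "(- ?E * A $$ (1, 0)) * A $$ (0, 1) + (?E * A $$ (0, 0)) * A $$ (1, 1) = (det B)\<^sup>2"
      unfolding of_int_power square by (simp add: algebra_simps)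
    then show "0 \<le> (- ?E * A $$ (1, 0)) * A $$ (0, 1) + (?E * A $$ (0, 0)) * A $$ (1, 1)" by simp
  qed (use k in auto)
  then have "0 \<le> real_of_int (det B * (A $$ (0, 0) * t\<^sub>2 - t\<^sub>1 * A $$ (1, 0)))"
    by (simp add: algebra_simps)
  then show "0 \<le> det B * (A $$ (0, 0) * t\<^sub>2 - t\<^sub>1 * A $$ (1, 0))" by (simp only: of_int_0_le_iff)
qed

end

section \<open>From the hypotheses to the run of the solver\<close>

text \<open>With \<open>S\<close> the input size, entries are at most \<open>2 ^ S\<close>, so the
  determinant is at most \<open>2 ^ (2 * S + 1)\<close> and its square, the initial diagonal entry,
  at most \<open>2 ^ (4 * S + 2) \<le> 2 ^ (6 * S)\<close>.\<close>

lemma solvable_system_of_cone_instance: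
  assumes "cone_instance n A B N b" and gcd: "gcd_minors2 A = 1"
  shows "solvable_system n (\<lambda>j. A $$ (0, j)) (\<lambda>j. A $$ (1, j)) (b $ 0) (b $ 1)
    (2 ^ (6 * binary_size (encode A b)))"
proof -
  interpret cone_instance n A B N b by (rule assms(1))
  define S where "S = binary_size (encode A b)"
  note load = load_encode[OF A b]
  have S: "n < S" "1 \<le> S" using binary_size_ge(1)[of "encode A b"] load(6) unfolding S_def by simp_all
  have small: "\<bar>load (encode A b) a\<bar> \<le> 2 ^ S" for a unfolding S_def by (rule abs_load_le)
  have mono: "(2 :: int) ^ S \<le> 2 ^ (6 * S)" "(2 :: int) ^ (4 * S + 2) \<le> 2 ^ (6 * S)"
    using S(2) by (intro power_increasing; simp)+
  have w: "\<bar>A $$ (0, j)\<bar> \<le> 2 ^ S" "\<bar>A $$ (1, j)\<bar> \<le> 2 ^ S" if "j < n" for j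
    using small load(4,5)[OF that] by metis+
  have minor: "det (mat_of_cols 2 [col A i, col A j]) = A $$ (0, i) * A $$ (1, j) - A $$ (0, j) * A $$ (1, i)"
    if "i < n" "j < n" for i j
    using A that by (subst det_2x2) (auto simp: mat_of_cols_index)
  let ?E = "A $$ (0, 0) * A $$ (1, 1) - A $$ (0, 1) * A $$ (1, 0)"
  interpret column_system n "\<lambda>j. A $$ (0, j)" "\<lambda>j. A $$ (1, j)" "b $ 0" "b $ 1" "2 ^ (6 * S)"
  proof
    show "2 \<le> n" using n by simp
    have "int n \<le> 2 ^ S" using S(1) of_nat_less_two_power[of S, where ?'a = int] by linarith
    then show "int n \<le> 2 ^ (6 * S)" using mono(1) by (rule order_trans)
    show "\<bar>A $$ (0, j)\<bar> \<le> 2 ^ (6 * S)" "\<bar>A $$ (1, j)\<bar> \<le> 2 ^ (6 * S)" if "j < n" for j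
      using w[OF that] mono(1) by (blast intro: order_trans)+
    show "\<bar>b $ 0\<bar> \<le> 2 ^ (6 * S)" "\<bar>b $ 1\<bar> \<le> 2 ^ (6 * S)"
      using small[of 1] small[of 2] mono(1) unfolding load(2,3) by (blast intro: order_trans)+
    show "?E \<noteq> 0" using det_B unfolding det_B_eq .
    have "\<bar>A $$ (0, 0) * A $$ (1, 1)\<bar> \<le> 2 ^ S * 2 ^ S" "\<bar>A $$ (0, 1) * A $$ (1, 0)\<bar> \<le> 2 ^ S * 2 ^ S"
      using w[of 0] w[of 1] n by (intro abs_mult_mono; simp)+
    then have "\<bar>?E\<bar> \<le> 2 * (2 ^ S * 2 ^ S)" by linarith
    also have "\<dots> = \<bar>2 ^ (2 * S + 1)\<bar>" unfolding mult_2 power_add by simp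
    finally have "?E\<^sup>2 \<le> (2 ^ (2 * S + 1))\<^sup>2" unfolding abs_le_square_iff .
    also have "\<dots> = 2 ^ (4 * S + 2)" by (simp only: power_mult[symmetric]) simp
    finally show "?E\<^sup>2 \<le> 2 ^ (6 * S)" using mono(2) by linarith
  qed
  have E: "E = det B" unfolding E_def det_B_eq ..
  show ?thesis
    unfolding S_def[symmetric]
  proof
    show "d dvd 1" if "\<And>i j. i < j \<Longrightarrow> j < n \<Longrightarrow> d dvd A $$ (0, i) * A $$ (1, j) - A $$ (0, j) * A $$ (1, i)" for d
      unfolding gcd[symmetric] gcd_minors2_def
      using that minor A by (intro Gcd_greatest) auto
  next
    fix k :: "nat \<Rightarrow> int"
    assume "\<And>j. 0 \<le> k j" "(\<Sum>j = 2..<n. k j) \<le> \<bar>E\<bar> - 1"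
    then show "0 \<le> E * ((b $ 0 - (\<Sum>j = 2..<n. k j * A $$ (0, j))) * A $$ (1, 1)
          - A $$ (0, 1) * (b $ 1 - (\<Sum>j = 2..<n. k j * A $$ (1, j)))) \<and>
        0 \<le> E * (A $$ (0, 0) * (b $ 1 - (\<Sum>j = 2..<n. k j * A $$ (1, j)))
          - (b $ 0 - (\<Sum>j = 2..<n. k j * A $$ (0, j))) * A $$ (1, 0))"
      unfolding E using cramer_nonneg[of k] by blast
  qed
qed

theorem corollary1p2:
  shows "\<exists>(P :: program) (p :: nat poly).
    \<forall>(n :: nat) (A :: int mat) (B :: int mat) (N :: int mat) (b :: int vec).
      n > 2 \<longrightarrow>
      B \<in> carrier_mat 2 2 \<longrightarrow>
      N \<in> carrier_mat 2 (n - 2) \<longrightarrow>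
      A = block_row B N \<longrightarrow>
      det B \<noteq> 0 \<longrightarrow>
      col_cone B = col_cone A \<longrightarrow>
      gcd_minors2 A = 1 \<longrightarrow>
      {x \<in> carrier_vec n. 0\<^sub>v n \<le> x \<and> real_mat A *\<^sub>v x = 0\<^sub>v 2} = {0\<^sub>v n} \<longrightarrow>
      b \<in> carrier_vec 2 \<longrightarrow>
      real_vec b \<in>
        (longest_column B * longest_column N / real_of_int \<bar>det B\<bar> * (real_of_int \<bar>det B\<bar> - 1))
          \<cdot>\<^sub>v real_vec (col_sum A) +o col_cone A \<longrightarrow>
      (\<exists>t s x. exec P (load (encode A b)) t s \<and>
        t \<le> poly p (binary_size (encode A b)) \<and>
        x \<in> carrier_vec n \<and> 0\<^sub>v n \<le> x \<and> A *\<^sub>v x = b \<and>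
        holds_vec s x)"
proof (intro exI[of _ solver] exI[of _ "monom (solver_factor * (2 * 30 ^ 3)) 4"] allI impI)
  fix n A B N b
  assume "n > 2" "B \<in> carrier_mat 2 2" "N \<in> carrier_mat 2 (n - 2)" "A = block_row B N" "det B \<noteq> 0"
    "col_cone B = col_cone A" "gcd_minors2 A = 1" "b \<in> carrier_vec 2"
    "real_vec b \<in> (longest_column B * longest_column N / real_of_int \<bar>det B\<bar> * (real_of_int \<bar>det B\<bar> - 1))
          \<cdot>\<^sub>v real_vec (col_sum A) +o col_cone A"
  then have inst: "cone_instance n A B N b" by unfold_locales
  interpret cone_instance n A B N b by (rule inst)
  define S where "S = binary_size (encode A b)"
  let ?s = "load (encode A b)"
  interpret solvable_system n "\<lambda>j. A $$ (0, j)" "\<lambda>j. A $$ (1, j)" "b $ 0" "b $ 1" "2 ^ (6 * S)"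
    unfolding S_def by (rule solvable_system_of_cone_instance[OF inst \<open>gcd_minors2 A = 1\<close>])
  note load = load_encode[OF A b]
  have S: "Suc n \<le> 2 * S" "1 \<le> S"
    using binary_size_ge(1)[of "encode A b"] load(6) unfolding S_def by simp_all
  have "(2 :: int) ^ S \<le> 2 ^ (6 * S)" by (intro power_increasing) auto
  then have "bounded (2 ^ (6 * S)) ?s"
    using abs_load_le[of "encode A b"] unfolding bounded_def S_def[symmetric] by (meson order_trans)
  then have "input ?s" unfolding input_def using load by simp
  then obtain t s where run: "exec solver ?s t s" "t \<le> solver_factor * (Suc n * bsize U ^ 3)" "solution s"
    using solver_correct unfolding runs_to_def by blast
  \<comment> \<open>Since \<open>24 < 2 ^ 5\<close>, \<open>U\<close> has at most
    \<open>24 * S + 6 \<le> 30 * S\<close> bits. The cube of this times the factor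
    \<open>n + 1 \<le> 2 * S\<close> from the loops gives the coefficient \<open>2 * 30 ^ 3\<close>
    and the degree 4.\<close>
  have "\<bar>U\<bar> < 2 ^ (24 * S + 5)"
    unfolding U_def by (simp add: power_add flip: power_mult)
  then have "bsize U \<le> Suc (24 * S + 5)" by (simp only: bsize_le_iff)
  then have "bsize U \<le> 30 * S" using S(2) by linarith
  then have "Suc n * bsize U ^ 3 \<le> (2 * S) * (30 * S) ^ 3"
    using S(1) by (intro mult_le_mono power_mono) auto
  also have "\<dots> = (2 * 30 ^ 3) * S ^ 4" by (simp add: power_mult_distrib power3_eq_cube power4_eq_xxxx)
  finally have "t \<le> solver_factor * ((2 * 30 ^ 3) * S ^ 4)"
    using run(2) by (meson mult_le_mono2 order_trans)
  then have time: "t \<le> poly (monom (solver_factor * (2 * 30 ^ 3)) 4) S"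
    by (simp only: poly_monom mult.assoc)
  define x where "x = vec n (\<lambda>j. s (int j))"
  have "A *\<^sub>v x = b"
  proof (intro eq_vecI)
    show "dim_vec (A *\<^sub>v x) = dim_vec b" using A b by simp
    fix i assume "i < dim_vec b"
    then have i: "i < 2" using b by simp
    have "(A *\<^sub>v x) $ i = (\<Sum>j<n. A $$ (i, j) * x $ j)"
      using A i by (intro mult_mat_vec_index_sum) (auto simp: x_def)
    also have "\<dots> = (\<Sum>j<n. s (int j) * A $$ (i, j))" by (simp add: x_def mult.commute)
    also have "\<dots> = b $ i"
      using run(3) i unfolding solution_def by (cases "i = 0") (auto simp: less_2_cases_iff)
    finally show "(A *\<^sub>v x) $ i = b $ i" .
  qed
  moreover have "0\<^sub>v n \<le> x" using run(3) unfolding solution_def x_def less_eq_vec_def by simp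
  moreover have "x \<in> carrier_vec n" "holds_vec s x" unfolding x_def holds_vec_def by simp_all
  ultimately show "\<exists>t s x. exec solver ?s t s \<and>
        t \<le> poly (monom (solver_factor * (2 * 30 ^ 3)) 4) (binary_size (encode A b)) \<and>
        x \<in> carrier_vec n \<and> 0\<^sub>v n \<le> x \<and> A *\<^sub>v x = b \<and> holds_vec s x"
    using run(1) time unfolding S_def by blast
qed

end
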